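(* Let $X$ be any locally compact Hausdorff topological space, let $k$ be any lower semicontinuous, nonnegative, symmetric kernel function on $X$, and let $\emptyset\neq K\subset X$ be compact. Then $A(K)$ consists of one single point of $[0,+\infty]$. Furthermore, if $k$ is continuous (and real-valued), then even $R(K)$ consists of only one point.
   Context: A nonnegative symmetric lower semicontinuous kernel on $X$ is a function $k:X\times X\to[0,+\infty]$ that is lower semicontinuous on $X\times X$ and satisfies $k(x,y)=k(y,x)$ for all $x,y\in X$. "Continuous kernel" means that $k$ is a continuous function $X\times X\to[0,+\infty)$. $\mathfrak{M}_1(K)$ is the set of regular Borel probability measures on $X$ supported in the compact set $K$. The potential of $\mu$ is $U^\mu(x)=\int_X k(x,y)\,d\mu(y)\in[0,+\infty]$. For $E\subset[0,+\infty]$, $\overline{\mathrm{conv}}\,E$ denotes the closed convex hull of $E$ in $[0,+\infty]$ (compact, with its usual topology), e.g. $\overline{\mathrm{conv}}\,(0,+\infty)=[0,+\infty]$ and $\overline{\mathrm{conv}}\,\{+\infty\}=\{+\infty\}$. Define $$R(K)=\bigcap_{n=1}^\infty\ \bigcap_{w_1,\dots,w_n\in K}\overline{\mathrm{conv}}\Big\{\tfrac1n\sum_{j=1}^n k(x,w_j): x\in K\Big\},\qquad A(K)=\bigcap_{\mu\in\mathfrak{M}_1(K)}\overline{\mathrm{conv}}\{U^\mu(x): x\in K\}.$$ The points $w_1,\dots,w_n$ need not be distinct. *)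

theory Defs
  imports "HOL-Probability.Probability"
begin

definition lower_semicontinuous :: "('a::topological_space \<Rightarrow> ennreal) \<Rightarrow> bool" where
  "lower_semicontinuous f \<longleftrightarrow> (\<forall>a. open {x. a < f x})"

definition symmetric_lsc_kernel :: "('a::topological_space \<Rightarrow> 'a \<Rightarrow> ennreal) \<Rightarrow> bool" where
  "symmetric_lsc_kernel k \<longleftrightarrow>
     lower_semicontinuous (\<lambda>(x, y). k x y) \<and> (\<forall>x y. k x y = k y x)"

(* The topology of [0,+oo) is the subspace topology of [0,+oo], so continuity
   into [0,+oo) is continuity into ennreal together with finiteness. *)
definition continuous_kernel :: "('a::topological_space \<Rightarrow> 'a \<Rightarrow> ennreal) \<Rightarrow> bool" where
  "continuous_kernel k \<longleftrightarrow>
     continuous_on UNIV (\<lambda>(x, y). k x y) \<and> (\<forall>x y. k x y < \<infinity>)"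

definition regular_borel_measure :: "'a::topological_space measure \<Rightarrow> bool" where
  "regular_borel_measure M \<longleftrightarrow> sets M = sets borel \<and>
     (\<forall>B\<in>sets borel.
        emeasure M B = (INF U\<in>{U. B \<subseteq> U \<and> open U}. emeasure M U) \<and>
        emeasure M B = (SUP C\<in>{C. C \<subseteq> B \<and> compact C}. emeasure M C))"

definition measure_support :: "'a::topological_space measure \<Rightarrow> 'a set" where
  "measure_support M = {x. \<forall>U. open U \<longrightarrow> x \<in> U \<longrightarrow> 0 < emeasure M U}"

definition prob_measures_on :: "'a::topological_space set \<Rightarrow> 'a measure set" where
  "prob_measures_on K = {M. prob_space M \<and> regular_borel_measure M \<and> measure_support M \<subseteq> K}"

definition potential :: "('a \<Rightarrow> 'a \<Rightarrow> ennreal) \<Rightarrow> 'a measure \<Rightarrow> 'a \<Rightarrow> ennreal" where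
  "potential k M x = (\<integral>\<^sup>+ y. k x y \<partial>M)"

(* Convex subsets of the extended half-line are its order-convex subsets
   (intervals, possibly containing +oo); inside [0,+oo) these are the usual
   convex sets.  In particular the hull of {0, +oo} is all of [0,+oo]. *)
definition closed_convex_hull :: "ennreal set \<Rightarrow> ennreal set" where
  "closed_convex_hull E = (\<lambda>C. closed C \<and> (\<forall>a\<in>C. \<forall>b\<in>C. {a..b} \<subseteq> C)) hull E"

definition rendezvous_set :: "('a \<Rightarrow> 'a \<Rightarrow> ennreal) \<Rightarrow> 'a set \<Rightarrow> ennreal set" where
  "rendezvous_set k K =
     (\<Inter>n\<in>{1::nat..}. \<Inter>w\<in>{w. \<forall>j\<in>{1..n}. w j \<in> K}.
        closed_convex_hull ((\<lambda>x. (\<Sum>j=1..n. k x (w j)) / of_nat n) ` K))"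

definition average_set :: "('a::topological_space \<Rightarrow> 'a \<Rightarrow> ennreal) \<Rightarrow> 'a set \<Rightarrow> ennreal set" where
  "average_set k K = (\<Inter>M\<in>prob_measures_on K. closed_convex_hull (potential k M ` K))"

end

theory Submission
  imports Defs
begin

text \<open>
  The hulls are the intervals $[\inf_K U^\mu, \sup_K U^\mu]$, so the claim is the minimax identity
  $\sup_\mu \inf_K U^\mu = \inf_\nu \sup_K U^\nu$. The inequality from left to right is Fubini for
  $\int U^\mu\,d\nu$; since the Borel sets of $X \times X$ can be larger than the product
  sigma-algebra, $k$ is first replaced on $K$ by a product-measurable minorant, a maximum of finitely
  many functions $1_V(x)\,u(y)$ with $V$ open, whose $\mu$-integrals in $y$ are still large.

  For the other inequality let $s < t$. By convex separation in finite dimensions, for each finite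
  $F \subseteq K$ either some average over points of $F$ has potential at least $s$ on $K$, or some
  average over points of $K$ has potential at most $t$ on $F$. In the latter case for all $F$,
  Tychonoff's theorem applied to set functions yields a finitely additive probability with potential
  at most $t$ on $K$. Its values on compact sets generate, by Caratheodory's construction, a regular
  Borel measure that is no larger on open sets, hence has no larger integrals of lower
  semicontinuous functions. For continuous $k$ a finite net $F$ makes this limit unnecessary.
\<close>

section \<open>Intervals and the finite minimax theorem\<close>

text \<open>A nonempty closed subset of \<open>ennreal\<close> contains its infimum and its
  supremum. Hence a closed order-convex superset of \<open>E\<close> contains both bounds of
  \<open>closure E\<close> and everything between them.\<close>

lemma closed_convex_hull_eq_Icc:
  assumes "E \<noteq> {}"
  shows "closed_convex_hull E = {Inf E..Sup E}"
proof
  show "closed_convex_hull E \<subseteq> {Inf E..Sup E}"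
    unfolding closed_convex_hull_def
    by (rule hull_minimal) (auto intro: Inf_lower Sup_upper order_trans)
  show "{Inf E..Sup E} \<subseteq> closed_convex_hull E"
    unfolding closed_convex_hull_def hull_def
  proof (intro Inter_greatest)
    fix C assume "C \<in> {C. (closed C \<and> (\<forall>a\<in>C. \<forall>b\<in>C. {a..b} \<subseteq> C)) \<and> E \<subseteq> C}"
    then have C: "closed C" "\<And>a b. a \<in> C \<Longrightarrow> b \<in> C \<Longrightarrow> {a..b} \<subseteq> C" "E \<subseteq> C"
      by auto
    have "closure E \<subseteq> C" "closure E \<noteq> {}"
      using C assms by (auto simp: closure_minimal)
    then have "Inf (closure E) \<in> C" "Sup (closure E) \<in> C"
      using closed_contains_Inf_cl[of "closure E"] closed_contains_Sup_cl[of "closure E"] by auto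
    moreover have "Inf (closure E) \<le> Inf E" "Sup E \<le> Sup (closure E)"
      by (auto intro!: Inf_superset_mono Sup_subset_mono closure_subset)
    ultimately show "{Inf E..Sup E} \<subseteq> C"
      using C(2)[of "Inf (closure E)" "Sup (closure E)"] by (meson atLeastatMost_subset_iff order_trans)
  qed
qed

text \<open>By \<open>le\<close> the supremum of the left ends is at most the infimum of the right
  ends; a strict gap between the two would contain some \<open>s < t\<close> violating
  \<open>gap\<close>. Asking for two levels instead of one leaves room for the approximations by
  which \<open>gap\<close> is verified later.\<close>

lemma INT_Icc_singleton:
  fixes m M :: "'i \<Rightarrow> 'b::{complete_linorder, dense_linorder}"
  assumes le: "\<And>i j. i \<in> I \<Longrightarrow> j \<in> I \<Longrightarrow> m i \<le> M j"
    and gap: "\<And>s t. s < t \<Longrightarrow> (\<exists>i\<in>I. s \<le> m i) \<or> (\<exists>j\<in>I. M j \<le> t)"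
  shows "\<exists>a. (\<Inter>i\<in>I. {m i..M i}) = {a}"
proof -
  have INF_le: "(INF j\<in>I. M j) \<le> (SUP i\<in>I. m i)"
  proof (rule ccontr)
    assume "\<not> ?thesis"
    then obtain s where s: "(SUP i\<in>I. m i) < s" "s < (INF j\<in>I. M j)"
      using dense not_le by metis
    then obtain t where t: "s < t" "t < (INF j\<in>I. M j)"
      using dense by blast
    from gap[OF t(1)] show False
    proof (elim disjE bexE)
      fix i assume "i \<in> I" "s \<le> m i"
      then have "s \<le> (SUP i\<in>I. m i)" by (auto intro: SUP_upper2)
      with s(1) show False by simp
    next
      fix j assume "j \<in> I" "M j \<le> t"
      then have "(INF j\<in>I. M j) \<le> t" by (auto intro: INF_lower2)
      with t(2) show False by simp
    qed
  qed
  have "(\<Inter>i\<in>I. {m i..M i}) = {SUP i\<in>I. m i}"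
  proof (intro equalityI subsetI)
    fix x assume "x \<in> (\<Inter>i\<in>I. {m i..M i})"
    then have "(SUP i\<in>I. m i) \<le> x" "x \<le> (INF j\<in>I. M j)"
      by (auto intro: SUP_least INF_greatest)
    with INF_le show "x \<in> {SUP i\<in>I. m i}" by simp
  qed (use le in \<open>auto intro: SUP_upper SUP_least\<close>)
  then show ?thesis by blast
qed

text \<open>The sum of \<open>S\<close> and the open positive quadrant is convex and misses the
  origin, so a line through the origin bounds it on one side. Large quadrant vectors force both
  coefficients of its normal to be nonnegative, and small ones give the inequality on
  \<open>S\<close> itself.\<close>

lemma plane_separation:
  fixes S :: "(real \<times> real) set"
  assumes "convex S" and neg: "\<And>a b. (a, b) \<in> S \<Longrightarrow> \<not> (a < 0 \<and> b < 0)"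
  obtains \<alpha> \<beta> where "\<alpha> \<ge> 0" "\<beta> \<ge> 0" "\<alpha> + \<beta> = (1::real)"
    "\<And>a b. (a, b) \<in> S \<Longrightarrow> 0 \<le> \<alpha> * a + \<beta> * b"
proof (cases "S = {}")
  case True
  then show ?thesis using that[of 1 0] by simp
next
  case False
  then obtain a0 b0 where ab0: "(a0, b0) \<in> S" by auto
  let ?P = "{0::real<..} \<times> {0::real<..}"
  let ?T = "{x + y | x y. x \<in> S \<and> y \<in> ?P}"
  have "convex ?T"
  proof -
    have "?T = (\<Union>x\<in>S. \<Union>y\<in>?P. {x + y})" by blast
    then show ?thesis
      using convex_sums[OF \<open>convex S\<close> convex_Times[of "{0::real<..}" "{0::real<..}"]]
      by (simp only: convex_real_interval)
  qed
  moreover have "0 \<notin> ?T"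
  proof
    assume "0 \<in> ?T"
    then obtain a b p q where "(a, b) \<in> S" "p > 0" "q > 0" "a + p = 0" "b + q = 0"
      by (auto simp: zero_prod_def)
    then show False using neg[of a b] by auto
  qed
  ultimately obtain z where z: "z \<noteq> 0" "\<And>x. x \<in> ?T \<Longrightarrow> 0 \<le> inner z x"
    by (meson separating_hyperplane_set_0)
  obtain \<alpha> \<beta> where ab: "z = (\<alpha>, \<beta>)" by (cases z)
  have h: "0 \<le> \<alpha> * (a + p) + \<beta> * (b + q)" if "(a, b) \<in> S" "p > 0" "q > 0" for a b p q
  proof -
    have "(a, b) + (p, q) \<in> ?T" using that by blast
    from z(2)[OF this] show ?thesis by (simp add: ab)
  qed
  have lim: "0 \<le> v" if "\<And>p. p > 0 \<Longrightarrow> 0 \<le> u * p + v" for u v :: real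
  proof (rule tendsto_lowerbound)
    show "((\<lambda>p. u * p + v) \<longlongrightarrow> v) (at_right 0)"
      by (auto intro!: tendsto_eq_intros)
    show "\<forall>\<^sub>F p in at_right 0. 0 \<le> u * p + v"
      using that by (auto simp: eventually_at_right_less eventually_at_filter)
  qed simp
  \<comment> \<open>Replacing \<open>p\<close> by \<open>1 / p\<close> and multiplying by
    \<open>p\<close> exchanges slope and constant term, so \<open>lim\<close> applies to the slope
    as well.\<close>
  have lim2: "0 \<le> u" if "\<And>p. p > 0 \<Longrightarrow> 0 \<le> u * p + v" for u v :: real
  proof (rule lim)
    fix p :: real assume "p > 0"
    then show "0 \<le> v * p + u"
      using that[of "1 / p"] by (simp add: field_simps)
  qed
  have a: "0 \<le> \<alpha>"
    by (rule lim2[of _ "\<alpha> * a0 + \<beta> * (b0 + 1)"]) (use h[OF ab0, of _ 1] in \<open>simp add: algebra_simps\<close>)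
  have b: "0 \<le> \<beta>"
    by (rule lim2[of _ "\<alpha> * (a0 + 1) + \<beta> * b0"]) (use h[OF ab0, of 1] in \<open>simp add: algebra_simps\<close>)
  have c: "0 \<le> \<alpha> * a + \<beta> * b" if "(a, b) \<in> S" for a b
    by (rule lim[of "\<alpha> + \<beta>"]) (use h[OF that] in \<open>simp add: algebra_simps\<close>)
  have pos: "\<alpha> + \<beta> > 0"
    using a b z(1) ab by (auto simp: zero_prod_def order_less_le)
  show ?thesis
  proof (rule that[of "\<alpha> / (\<alpha> + \<beta>)" "\<beta> / (\<alpha> + \<beta>)"])
    show "0 \<le> \<alpha> / (\<alpha> + \<beta>) * x + \<beta> / (\<alpha> + \<beta>) * y" if "(x, y) \<in> S" for x y
      using c[OF that] pos by (simp add: add_divide_distrib[symmetric])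
  qed (use a b pos in \<open>auto simp: add_divide_distrib[symmetric]\<close>)
qed

text \<open>Induction on \<open>F\<close>. If no member of \<open>C\<close> is negative on all of
  \<open>insert j F\<close>, the induction hypothesis for the members negative at \<open>j\<close>
  yields weights \<open>l\<close> on \<open>F\<close>. The pairs formed by the
  \<open>l\<close>-weighted sum of \<open>c\<close> and by \<open>c j\<close> then avoid the open
  negative quadrant, and \<open>plane_separation\<close> tells how to mix the coordinate
  \<open>j\<close> into the weights.\<close>

lemma finite_theorem_of_alternatives:
  fixes C :: "('i \<Rightarrow> real) set"
  assumes "finite F" "F \<noteq> {}"
    and "\<And>c d u. c \<in> C \<Longrightarrow> d \<in> C \<Longrightarrow> 0 \<le> u \<Longrightarrow> u \<le> 1 \<Longrightarrow> (\<lambda>i. (1 - u) * c i + u * d i) \<in> C"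
  shows "(\<exists>c\<in>C. \<forall>i\<in>F. c i < 0) \<or>
    (\<exists>l. (\<forall>i\<in>F. 0 \<le> l i) \<and> sum l F = 1 \<and> (\<forall>c\<in>C. 0 \<le> (\<Sum>i\<in>F. l i * c i)))"
  using assms
proof (induction F arbitrary: C rule: finite_ne_induct)
  case (singleton x)
  show ?case
    by (cases "\<exists>c\<in>C. c x < 0") (auto intro!: exI[of _ "\<lambda>_. 1"] simp: not_less)
next
  case (insert j F)
  note conv = insert.prems
  have conv': "(\<lambda>i. (1 - u) * c i + u * d i) \<in> {c \<in> C. c j < 0}"
    if "c \<in> {c \<in> C. c j < 0}" "d \<in> {c \<in> C. c j < 0}" "0 \<le> u" "u \<le> 1" for c d u
  proof -
    have "(1 - u) * c j + u * d j < 0"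
      using that convex_bound_lt[of "c j" 0 "d j" "1 - u" u] by auto
    then show ?thesis using that conv by auto
  qed
  show ?case
  proof (cases "\<exists>c\<in>C. \<forall>i\<in>insert j F. c i < 0")
    case False
    then have "\<not> (\<exists>c\<in>{c \<in> C. c j < 0}. \<forall>i\<in>F. c i < 0)" by auto
    with insert.IH[of "{c \<in> C. c j < 0}", OF conv'] obtain l where
      l: "\<And>i. i \<in> F \<Longrightarrow> 0 \<le> l i" "sum l F = 1"
        "\<And>c. c \<in> C \<Longrightarrow> c j < 0 \<Longrightarrow> 0 \<le> (\<Sum>i\<in>F. l i * c i)"
      by auto
    let ?g = "\<lambda>c. (\<Sum>i\<in>F. l i * c i, c j)"
    have "convex (?g ` C)"
    proof (rule convexI, clarsimp )
      fix u v :: real and c d assume "0 \<le> u" "0 \<le> v" "u + v = 1" "c \<in> C" "d \<in> C"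
      then have A: "(\<lambda>i. u * c i + v * d i) \<in> C"
        using conv[of c d v] by (metis (no_types, lifting) ext add_diff_cancel_right' le_add_same_cancel2)
      have B: "?g (\<lambda>i. u * c i + v * d i) =
          (u * (\<Sum>i\<in>F. l i * c i) + v * (\<Sum>i\<in>F. l i * d i), u * c j + v * d j)"
        by (simp add: sum_distrib_left sum.distrib[symmetric] algebra_simps)
      show "(u * (\<Sum>i\<in>F. l i * c i) + v * (\<Sum>i\<in>F. l i * d i), u * c j + v * d j) \<in> ?g ` C"
        by (rule image_eqI[where f = ?g, OF B[symmetric] A])
    qed
    then obtain \<alpha> \<beta> where ab: "\<alpha> \<ge> 0" "\<beta> \<ge> 0" "\<alpha> + \<beta> = (1::real)"
      "\<And>a b. (a, b) \<in> ?g ` C \<Longrightarrow> 0 \<le> \<alpha> * a + \<beta> * b"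
      by (rule plane_separation) (use l(3) in force)+
    define l' where "l' i = (if i = j then \<beta> else \<alpha> * l i)" for i
    have *: "(\<Sum>i\<in>insert j F. l' i * c i) = \<beta> * c j + \<alpha> * (\<Sum>i\<in>F. l i * c i)" for c :: "'i \<Rightarrow> real"
    proof -
      have "(\<Sum>i\<in>F. l' i * c i) = (\<Sum>i\<in>F. \<alpha> * (l i * c i))"
        using insert.hyps by (intro sum.cong) (auto simp: l'_def)
      then show ?thesis
        using insert.hyps by (simp add: sum_distrib_left) (simp add: l'_def)
    qed
    have "sum l' (insert j F) = 1"
      using *[of "\<lambda>_. 1"] l(2) ab(3) by simp
    moreover have "0 \<le> (\<Sum>i\<in>insert j F. l' i * c i)" if "c \<in> C" for c
      unfolding * using ab(4)[of "\<Sum>i\<in>F. l i * c i" "c j"] that by (auto simp: add.commute)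
    ultimately show ?thesis
      using ab l by (intro disjI2 exI[of _ l']) (auto simp: l'_def)
  qed blast
qed

text \<open>Converts integer weights into the sequences with repetition over which averages are
  formed; the induction appends \<open>c a\<close> copies of the new point \<open>a\<close>.\<close>

lemma sequence_with_multiplicities:
  fixes c :: "'a \<Rightarrow> nat"
  assumes "finite A"
  shows "\<exists>w::nat \<Rightarrow> 'a. (\<forall>j\<in>{1..sum c A}. w j \<in> A) \<and>
    (\<forall>g::'a \<Rightarrow> ennreal. (\<Sum>j=1..sum c A. g (w j)) = (\<Sum>x\<in>A. of_nat (c x) * g x))"
  using assms
proof induction
  case (insert a A)
  then obtain w where w: "\<And>j. j \<in> {1..sum c A} \<Longrightarrow> w j \<in> A"
    "\<And>g::'a \<Rightarrow> ennreal. (\<Sum>j=1..sum c A. g (w j)) = (\<Sum>x\<in>A. of_nat (c x) * g x)"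
    by blast
  let ?w = "\<lambda>j. if j \<le> sum c A then w j else a"
  have "(\<Sum>j=1..sum c (insert a A). g (?w j)) = (\<Sum>x\<in>insert a A. of_nat (c x) * g x)"
    for g :: "'a \<Rightarrow> ennreal"
  proof -
    have "sum c (insert a A) = sum c A + c a"
      using insert.hyps by simp
    then have "(\<Sum>j=1..sum c (insert a A). g (?w j)) =
        (\<Sum>j=1..sum c A. g (?w j)) + (\<Sum>j=sum c A + 1..sum c A + c a. g (?w j))"
      by (simp only: sum.ub_add_nat[of 1 "sum c A" _ "c a"] le_add2)
    also have "(\<Sum>j=1..sum c A. g (?w j)) = (\<Sum>x\<in>A. of_nat (c x) * g x)"
      unfolding w(2)[symmetric] by (intro sum.cong) auto
    also have "(\<Sum>j=sum c A + 1..sum c A + c a. g (?w j)) = of_nat (c a) * g a"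
      by (subst sum.cong[where h = "\<lambda>_. g a", OF refl]) auto
    finally show ?thesis using insert.hyps by (simp add: add.commute)
  qed
  then show ?case
    using w(1) by (intro exI[of _ ?w]) auto
qed simp

text \<open>The theorem of alternatives is applied to vectors indexed by \<open>F\<close>, each the
  potential of a finitely supported probability on \<open>Y\<close> minus a level \<open>T\<close>
  between \<open>s\<close> and \<open>t\<close>. A vector with only negative entries gives an
  average over \<open>K\<close> that is small on \<open>F\<close>; weights \<open>l\<close> on
  \<open>F\<close> give an average that is large on \<open>K\<close>. Real weights become integer
  multiplicities relative to a large \<open>N\<close>, and the gap between \<open>s\<close> and
  \<open>t\<close> absorbs the rounding.\<close>

lemma finite_minimax:
  fixes f :: "'x \<Rightarrow> 'y \<Rightarrow> ennreal"
  assumes F: "finite F" "F \<noteq> {}" and "s < t"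
  shows "(\<exists>n\<ge>1. \<exists>w. (\<forall>j\<in>{1..n}. w j \<in> F) \<and>
            (\<forall>y\<in>K. s \<le> (\<Sum>j=1..n. f (w j) y) / of_nat n)) \<or>
         (\<exists>n\<ge>1. \<exists>v. (\<forall>j\<in>{1..n}. v j \<in> K) \<and>
            (\<forall>x\<in>F. (\<Sum>j=1..n. f x (v j)) / of_nat n \<le> t))"
proof -
  \<comment> \<open>Two intermediate levels are taken because each alternative spends its own gap:
    \<open>T\<close> to \<open>\<tau>\<close> pays for rounding down on \<open>K\<close>,
    \<open>\<sigma>\<close> to \<open>T\<close> for rounding up on \<open>F\<close>. Both levels are
    finite even if \<open>t\<close> is infinite.\<close>
  obtain T' where T': "s < T'" "T' < t" using dense[OF \<open>s < t\<close>] by blast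
  obtain T'' where T'': "T' < T''" "T'' < t" using dense[OF T'(2)] by blast
  define \<sigma> T \<tau> where "\<sigma> = enn2real s" "T = enn2real T'" "\<tau> = enn2real T''"
  have fin: "s < \<infinity>" "T' < \<infinity>" "T'' < \<infinity>"
    using T' T'' by (auto simp: top.not_eq_extremum[symmetric])
  have s: "s = ennreal \<sigma>" and \<tau>: "ennreal \<tau> < t" and nn: "0 \<le> \<sigma>"
    using fin T'' by (auto simp: \<sigma>_T_\<tau>_def)
  have less: "\<sigma> < T" "T < \<tau>"
    using T' T'' fin by (auto simp: \<sigma>_T_\<tau>_def enn2real_less_iff)
  \<comment> \<open>Points outside \<open>Y\<close> have infinite potential under every average that charges all of \<open>F\<close>.\<close>
  define Y where "Y = {y\<in>K. \<forall>x\<in>F. f x y < \<infinity>}"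
  define g where "g x y = enn2real (f x y)" for x y
  have g: "f x y = ennreal (g x y)" if "x \<in> F" "y \<in> Y" for x y
    using that by (auto simp: Y_def g_def)
  have g0: "0 \<le> g x y" for x y by (simp add: g_def)
  define C where "C = {c. \<exists>B \<nu>. finite B \<and> B \<subseteq> Y \<and> (\<forall>y\<in>B. 0 \<le> \<nu> y) \<and> sum \<nu> B = 1 \<and>
      c = (\<lambda>x. (\<Sum>y\<in>B. \<nu> y * g x y) - T)}"
  have conv: "(\<lambda>i. (1 - u) * c i + u * d i) \<in> C" if cd: "c \<in> C" "d \<in> C" and u: "0 \<le> u" "u \<le> 1" for c d u
  proof -
    obtain B1 \<nu>1 where 1: "finite B1" "B1 \<subseteq> Y" "\<forall>y\<in>B1. 0 \<le> \<nu>1 y" "sum \<nu>1 B1 = 1"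
      "c = (\<lambda>x. (\<Sum>y\<in>B1. \<nu>1 y * g x y) - T)" using cd(1)[unfolded C_def mem_Collect_eq] by (elim exE conjE) (rule that)
    obtain B2 \<nu>2 where 2: "finite B2" "B2 \<subseteq> Y" "\<forall>y\<in>B2. 0 \<le> \<nu>2 y" "sum \<nu>2 B2 = 1"
      "d = (\<lambda>x. (\<Sum>y\<in>B2. \<nu>2 y * g x y) - T)" using cd(2)[unfolded C_def mem_Collect_eq] by (elim exE conjE) (rule that)
    define \<nu> where "\<nu> y = (1 - u) * (if y \<in> B1 then \<nu>1 y else 0) + u * (if y \<in> B2 then \<nu>2 y else 0)" for y
    have *: "(\<Sum>y\<in>B1 \<union> B2. \<nu> y * h y) = (1 - u) * (\<Sum>y\<in>B1. \<nu>1 y * h y) + u * (\<Sum>y\<in>B2. \<nu>2 y * h y)"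
      for h :: "'y \<Rightarrow> real"
    proof -
      have "(\<Sum>y\<in>B1. \<nu>1 y * h y) = (\<Sum>y\<in>B1 \<union> B2. (if y \<in> B1 then \<nu>1 y else 0) * h y)"
        using 1 2 by (intro sum.mono_neutral_cong_left) auto
      moreover have "(\<Sum>y\<in>B2. \<nu>2 y * h y) = (\<Sum>y\<in>B1 \<union> B2. (if y \<in> B2 then \<nu>2 y else 0) * h y)"
        using 1 2 by (intro sum.mono_neutral_cong_left) auto
      ultimately show ?thesis
        by (simp add: \<nu>_def sum_distrib_left sum.distrib[symmetric] algebra_simps)
    qed
    have "sum \<nu> (B1 \<union> B2) = 1"
      using *[of "\<lambda>_. 1"] 1 2 by simp
    moreover have "(\<lambda>i. (1 - u) * c i + u * d i) = (\<lambda>x. (\<Sum>y\<in>B1 \<union> B2. \<nu> y * g x y) - T)"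
      by (simp add: * 1(5) 2(5) algebra_simps)
    moreover have "\<forall>y\<in>B1 \<union> B2. 0 \<le> \<nu> y"
      using 1(3) 2(3) u by (auto simp: \<nu>_def)
    ultimately show ?thesis
      using 1 2 unfolding C_def by (auto intro!: exI[of _ "B1 \<union> B2"] exI[of _ \<nu>])
  qed
  have "(\<exists>c\<in>C. \<forall>i\<in>F. c i < 0) \<or>
    (\<exists>l. (\<forall>i\<in>F. 0 \<le> l i) \<and> sum l F = 1 \<and> (\<forall>c\<in>C. 0 \<le> (\<Sum>i\<in>F. l i * c i)))"
    by (rule finite_theorem_of_alternatives[OF F]) (rule conv)
  then show ?thesis
  proof (elim disjE bexE exE conjE)
    fix c assume c: "c \<in> C" "\<forall>i\<in>F. c i < 0"
    obtain B \<nu> where B: "finite B" "B \<subseteq> Y" "\<forall>y\<in>B. 0 \<le> \<nu> y" "sum \<nu> B = 1"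
      "c = (\<lambda>x. (\<Sum>y\<in>B. \<nu> y * g x y) - T)"
      using c(1)[unfolded C_def mem_Collect_eq] by (elim exE conjE) (rule that)
    have BT: "(\<Sum>y\<in>B. \<nu> y * g x y) < T" if "x \<in> F" for x
      using c(2) that B(5) by simp
    \<comment> \<open>Rounding \<open>N * \<nu> y\<close> down loses at most one unit per point of
      \<open>B\<close>, so the total multiplicity is at least \<open>N - card B\<close>. The
      quotient makes \<open>N\<close> large enough for
      \<open>N * T \<le> (N - card B) * \<tau>\<close>; the extra \<open>card B\<close> keeps that
      total positive.\<close>
    obtain N :: nat where N0: "real (card B) * \<tau> / (\<tau> - T) + real (card B) < N"
      using reals_Archimedean2 by blast
    have "0 < T" using less nn by simp
    then have Nc: "card B < N" and N: "real N * T \<le> (real N - real (card B)) * \<tau>"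
    proof -
      have "0 \<le> real (card B) * \<tau> / (\<tau> - T)" using less \<open>0 < T\<close> by simp
      then show "card B < N" using N0 by linarith
      have "real (card B) * \<tau> / (\<tau> - T) \<le> N" using N0 by linarith
      then show "real N * T \<le> (real N - real (card B)) * \<tau>"
        using less by (simp add: field_simps)
    qed
    define m where "m y = nat \<lfloor>real N * \<nu> y\<rfloor>" for y
    have m_le: "real (m y) \<le> real N * \<nu> y" and m_ge: "real N * \<nu> y - 1 \<le> real (m y)" if "y \<in> B" for y
    proof -
      have "0 \<le> real N * \<nu> y" using B(3) that by simp
      then show "real (m y) \<le> real N * \<nu> y" "real N * \<nu> y - 1 \<le> real (m y)"
        unfolding m_def by linarith+
    qed
    let ?n = "sum m B"
    have "real N - real (card B) = (\<Sum>y\<in>B. real N * \<nu> y - 1)"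
      using B(4) by (simp add: sum_subtractf sum_distrib_left[symmetric])
    also have "\<dots> \<le> (\<Sum>y\<in>B. real (m y))" using m_ge by (intro sum_mono) auto
    finally have n: "real N - real (card B) \<le> real ?n" by simp
    then have n1: "1 \<le> ?n" using Nc by linarith
    then have n0: "0 < real ?n" by (simp only: of_nat_0_less_iff)
    obtain v where v: "\<forall>j\<in>{1..?n}. v j \<in> B"
      "\<And>h::'y \<Rightarrow> ennreal. (\<Sum>j=1..?n. h (v j)) = (\<Sum>x\<in>B. of_nat (m x) * h x)"
      using sequence_with_multiplicities[OF B(1), of m] by blast
    have "(\<Sum>j=1..?n. f x (v j)) / of_nat ?n \<le> t" if x: "x \<in> F" for x
    proof -
      have "(\<Sum>y\<in>B. real (m y) * g x y) \<le> (\<Sum>y\<in>B. real N * \<nu> y * g x y)"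
        using m_le g0 by (intro sum_mono mult_right_mono) auto
      also have "\<dots> = real N * (\<Sum>y\<in>B. \<nu> y * g x y)" by (simp add: sum_distrib_left mult.assoc)
      also have "\<dots> \<le> real N * T" using BT[OF x] by (intro mult_left_mono) auto
      also have "\<dots> \<le> (real N - real (card B)) * \<tau>" by (rule N)
      also have "\<dots> \<le> real ?n * \<tau>" using n less \<open>0 < T\<close> by (intro mult_right_mono) auto
      finally have le: "(\<Sum>y\<in>B. real (m y) * g x y) / real ?n \<le> \<tau>"
        using n0 by (simp only: pos_divide_le_eq mult.commute)
      have "(\<Sum>j=1..?n. f x (v j)) = (\<Sum>y\<in>B. of_nat (m y) * f x y)" by (rule v(2))
      also have "\<dots> = (\<Sum>y\<in>B. ennreal (real (m y) * g x y))"
        using B(2) g[OF x] g0 by (intro sum.cong) (auto simp: ennreal_mult ennreal_of_nat_eq_real_of_nat)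
      also have "\<dots> = ennreal (\<Sum>y\<in>B. real (m y) * g x y)" using g0 by simp
      finally have "(\<Sum>j=1..?n. f x (v j)) / of_nat ?n = ennreal ((\<Sum>y\<in>B. real (m y) * g x y) / real ?n)"
        using n1 g0 by (simp only: ennreal_of_nat_eq_real_of_nat) (subst divide_ennreal, auto intro!: sum_nonneg simp del: of_nat_sum)
      then show ?thesis using order_trans[OF ennreal_leI[OF le] less_imp_le[OF \<tau>]] by simp
    qed
    moreover have "\<forall>j\<in>{1..?n}. v j \<in> K" using v(1) B(2) by (auto simp: Y_def)
    ultimately show ?thesis using n1 by blast
  next
    fix l assume l: "\<forall>i\<in>F. 0 \<le> l i" "sum l F = 1" "\<forall>c\<in>C. 0 \<le> (\<Sum>i\<in>F. l i * c i)"
    \<comment> \<open>Point masses at single points of \<open>Y\<close> already belong to the family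
      \<open>C\<close>.\<close>
    have lg: "T \<le> (\<Sum>x\<in>F. l x * g x y)" if "y \<in> Y" for y
    proof -
      have "(\<lambda>x. g x y - T) \<in> C"
        unfolding C_def using that by (auto intro!: exI[of _ "{y}"] exI[of _ "\<lambda>_. 1"])
      then show ?thesis using l
        by (auto simp: right_diff_distrib sum_subtractf sum_distrib_right[symmetric])
    qed
    \<comment> \<open>Rounding up raises the total multiplicity from \<open>N\<close> to at most
      \<open>N + card F\<close>, and this \<open>N\<close> makes that increase cost no more than the
      gap between \<open>\<sigma>\<close> and \<open>T\<close>.\<close>
    obtain N :: nat where N0: "real (card F) * \<sigma> / (T - \<sigma>) < N"
      using reals_Archimedean2 by blast
    then have N: "(real N + real (card F)) * \<sigma> \<le> real N * T"
      using less by (simp add: field_simps)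
    \<comment> \<open>Rounding up strictly keeps every weight positive, as needed outside \<open>Y\<close>.\<close>
    define m where "m x = nat \<lfloor>real N * l x\<rfloor> + 1" for x
    have m_le: "real (m x) \<le> real N * l x + 1" and m_ge: "real N * l x \<le> real (m x)" if "x \<in> F" for x
    proof -
      have "0 \<le> real N * l x" using l(1) that by simp
      then show "real (m x) \<le> real N * l x + 1" "real N * l x \<le> real (m x)"
        unfolding m_def by linarith+
    qed
    let ?n = "sum m F"
    have "real ?n \<le> (\<Sum>x\<in>F. real N * l x + 1)" using m_le by (simp add: sum_mono)
    also have "\<dots> = real N + real (card F)"
      using l(2) by (simp add: sum.distrib sum_distrib_left[symmetric])
    finally have n: "real ?n \<le> real N + real (card F)" .
    have "?n \<noteq> 0" using F by (auto simp: m_def)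
    then have n1: "1 \<le> ?n" by linarith
    then have n0: "0 < real ?n" by (simp only: of_nat_0_less_iff)
    obtain w where w: "\<forall>j\<in>{1..?n}. w j \<in> F"
      "\<And>h::'x \<Rightarrow> ennreal. (\<Sum>j=1..?n. h (w j)) = (\<Sum>x\<in>F. of_nat (m x) * h x)"
      using sequence_with_multiplicities[OF F(1), of m] by blast
    have "s \<le> (\<Sum>j=1..?n. f (w j) y) / of_nat ?n" if y: "y \<in> K" for y
    proof (cases "y \<in> Y")
      case True
      have "real ?n * \<sigma> \<le> (real N + real (card F)) * \<sigma>" using n nn by (intro mult_right_mono) auto
      also have "\<dots> \<le> real N * T" by (rule N)
      also have "\<dots> \<le> real N * (\<Sum>x\<in>F. l x * g x y)" using lg[OF True] by (intro mult_left_mono) auto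
      also have "\<dots> = (\<Sum>x\<in>F. real N * l x * g x y)" by (simp add: sum_distrib_left mult.assoc)
      also have "\<dots> \<le> (\<Sum>x\<in>F. real (m x) * g x y)"
        using m_ge g0 by (intro sum_mono mult_right_mono) auto
      finally have le: "\<sigma> \<le> (\<Sum>x\<in>F. real (m x) * g x y) / real ?n"
        using n0 by (simp only: pos_le_divide_eq mult.commute)
      have "(\<Sum>j=1..?n. f (w j) y) = (\<Sum>x\<in>F. of_nat (m x) * f x y)" by (rule w(2))
      also have "\<dots> = (\<Sum>x\<in>F. ennreal (real (m x) * g x y))"
        using g[OF _ True] g0 by (intro sum.cong) (auto simp: ennreal_mult ennreal_of_nat_eq_real_of_nat)
      also have "\<dots> = ennreal (\<Sum>x\<in>F. real (m x) * g x y)" using g0 by simp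
      finally have "(\<Sum>j=1..?n. f (w j) y) / of_nat ?n = ennreal ((\<Sum>x\<in>F. real (m x) * g x y) / real ?n)"
        using n1 g0 by (simp only: ennreal_of_nat_eq_real_of_nat) (subst divide_ennreal, auto intro!: sum_nonneg simp del: of_nat_sum)
      then show ?thesis using ennreal_leI[OF le] s by simp
    next
      case False
      then obtain x where x: "x \<in> F" "f x y = \<infinity>"
        using y by (auto simp: Y_def less_top[symmetric])
      have "of_nat (m x) * f x y = \<infinity>" using x by (simp add: m_def ennreal_mult_top del: of_nat_Suc)
      then have "(\<Sum>x\<in>F. of_nat (m x) * f x y) = \<infinity>"
        using x F by (auto simp: sum.remove[of F x])
      then show ?thesis unfolding w(2)[of "\<lambda>x. f x y"] by (simp add: ennreal_top_divide del: of_nat_sum)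
    qed
    then show ?thesis using w(1) n1 by blast
  qed
qed

section \<open>Regular measures from finitely additive ones\<close>

lemma Hausdorff_space_euclidean_t2: "Hausdorff_space (euclidean :: 'a::t2_space topology)"
  unfolding Hausdorff_space_def disjnt_def
proof clarsimp
  fix x y :: 'a assume "x \<noteq> y"
  then show "\<exists>U. open U \<and> (\<exists>V. open V \<and> x \<in> U \<and> y \<in> V \<and> U \<inter> V = {})"
    using hausdorff[of x y] by blast
qed

text \<open>The compact sets \<open>C - U\<close> and \<open>C - V\<close> are disjoint, hence lie
  in disjoint open sets \<open>G\<close> and \<open>H\<close>. Removing \<open>G\<close> leaves a
  part inside \<open>U\<close>, removing \<open>H\<close> a part inside \<open>V\<close>, and no
  point is removed twice.\<close>

lemma compact_split:
  fixes C :: "'a::t2_space set"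
  assumes "compact C" "open U" "open V" "C \<subseteq> U \<union> V"
  obtains D E where "compact D" "compact E" "D \<subseteq> U" "E \<subseteq> V" "C = D \<union> E"
proof -
  have "compactin euclidean (C - U)" "compactin euclidean (C - V)"
    using assms by (auto intro: compact_diff)
  moreover have "disjnt (C - U) (C - V)"
    using assms(4) by (auto simp: disjnt_def)
  ultimately obtain G H where GH: "open G" "open H" "C - U \<subseteq> G" "C - V \<subseteq> H" "disjnt G H"
    using Hausdorff_space_compact_separation[OF Hausdorff_space_euclidean_t2, of "C - U" "C - V"]
    by (metis open_openin)
  show ?thesis
  proof (rule that)
    show "compact (C - G)" "compact (C - H)" using assms GH by (auto intro: compact_diff)
    show "C - G \<subseteq> U" "C - H \<subseteq> V" "C = (C - G) \<union> (C - H)"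
      using GH by (auto simp: disjnt_def)
  qed
qed

text \<open>The finitely additive \<open>m\<close> is regularized: \<open>\<tau>\<close>
  approximates open sets from inside by compact subsets of \<open>K\<close>, and
  \<open>\<nu>\<close> approximates arbitrary sets from outside by open ones. The first step can
  only lose mass on open sets, while compactness of \<open>K\<close> and \<open>m K = 1\<close>
  preserve the total mass. Caratheodory's construction then turns \<open>\<nu>\<close> into a
  measure on the Borel sets.\<close>

lemma additive_probability_le_regular_measure:
  fixes m :: "'a::t2_space set \<Rightarrow> ennreal"
  assumes K: "compact K" and add: "\<And>A B. A \<inter> B = {} \<Longrightarrow> m (A \<union> B) = m A + m B"
    and mU: "m UNIV = 1" and mK: "m K = 1"
  shows "\<exists>M\<in>prob_measures_on K. \<forall>U. open U \<longrightarrow> emeasure M U \<le> m U"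
proof -
  have mono: "m A \<le> m B" if "A \<subseteq> B" for A B
  proof -
    have "m B = m A + m (B - A)" using add[of A "B - A"] that by (simp add: Un_absorb1)
    then show ?thesis by simp
  qed
  have m_empty: "m {} = 0"
  proof -
    have "1 + m {} = 1 + 0" using add[of UNIV "{}"] mU by simp
    then show ?thesis by (subst (asm) ennreal_add_left_cancel) auto
  qed
  have m_Un: "m (A \<union> B) \<le> m A + m B" for A B
    using add[of A "B - A"] mono[of "B - A" B] by (simp add: add_left_mono)
  define \<tau> where "\<tau> U = (SUP C\<in>{C. compact C \<and> C \<subseteq> U \<inter> K}. m C)" for U
  define \<nu> where "\<nu> A = (INF U\<in>{U. open U \<and> A \<subseteq> U}. \<tau> U)" for A
  have \<tau>I: "m C \<le> \<tau> U" if "compact C" "C \<subseteq> U" "C \<subseteq> K" for C U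
    unfolding \<tau>_def by (rule SUP_upper) (use that in auto)
  have \<tau>D: "\<tau> U \<le> x" if "\<And>C. compact C \<Longrightarrow> C \<subseteq> U \<Longrightarrow> C \<subseteq> K \<Longrightarrow> m C \<le> x" for U x
    unfolding \<tau>_def by (rule SUP_least) (use that in auto)
  have \<tau>_le: "\<tau> U \<le> m U" for U
    by (rule \<tau>D) (rule mono)
  have \<tau>_mono: "\<tau> U \<le> \<tau> V" if "U \<subseteq> V" for U V
    by (rule \<tau>D) (use that in \<open>auto intro: \<tau>I\<close>)
  have \<tau>_empty: "\<tau> {} = 0"
    using \<tau>_le[of "{}"] m_empty by simp
  have \<tau>_Un: "\<tau> (U \<union> V) \<le> \<tau> U + \<tau> V" if "open U" "open V" for U V
  proof (rule \<tau>D)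
    fix C assume C: "compact C" "C \<subseteq> U \<union> V" "C \<subseteq> K"
    obtain D E where DE: "compact D" "compact E" "D \<subseteq> U" "E \<subseteq> V" "C = D \<union> E"
      by (rule compact_split[OF C(1) \<open>open U\<close> \<open>open V\<close> C(2)])
    have "m C \<le> m D + m E" unfolding DE(5) by (rule m_Un)
    also have "\<dots> \<le> \<tau> U + \<tau> V" using DE C by (intro add_mono \<tau>I) auto
    finally show "m C \<le> \<tau> U + \<tau> V" .
  qed
  have \<tau>_fin: "\<tau> (\<Union>i<n. U i) \<le> (\<Sum>i<n. \<tau> (U i))" if "\<And>i. open (U i)" for U and n :: nat
  proof (induction n)
    case (Suc n)
    have "\<tau> (\<Union>i<Suc n. U i) \<le> \<tau> (\<Union>i<n. U i) + \<tau> (U n)"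
      unfolding lessThan_Suc UN_insert using \<tau>_Un[of "\<Union>i<n. U i" "U n"] that
      by (simp add: Un_commute open_UN)
    also have "\<dots> \<le> (\<Sum>i<Suc n. \<tau> (U i))" using Suc by (simp add: add_right_mono)
    finally show ?case .
  qed (simp add: \<tau>_empty)
  \<comment> \<open>Here finite additivity becomes countable subadditivity: a compact
    \<open>C\<close> inside the union is covered by finitely many of the \<open>U i\<close>.\<close>
  have \<tau>_count: "\<tau> (\<Union>i. U i) \<le> (\<Sum>i. \<tau> (U i))" if U: "\<And>i. open (U i)" for U :: "nat \<Rightarrow> 'a set"
  proof (rule \<tau>D)
    fix C assume C: "compact C" "C \<subseteq> (\<Union>i. U i)" "C \<subseteq> K"
    obtain I where I: "finite I" "C \<subseteq> (\<Union>i\<in>I. U i)"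
      using compactE_image[OF C(1), of UNIV U] U C(2) by auto
    obtain n where "I \<subseteq> {..<n}" using I(1) finite_nat_iff_bounded by blast
    with I(2) have "C \<subseteq> (\<Union>i<n. U i)" by blast
    then have "m C \<le> \<tau> (\<Union>i<n. U i)" using C by (intro \<tau>I) auto
    also have "\<dots> \<le> (\<Sum>i<n. \<tau> (U i))" by (rule \<tau>_fin[OF U])
    also have "\<dots> \<le> (\<Sum>i. \<tau> (U i))" by (rule sum_le_suminf) auto
    finally show "m C \<le> (\<Sum>i. \<tau> (U i))" .
  qed
  have \<nu>I: "\<nu> A \<le> \<tau> U" if "open U" "A \<subseteq> U" for A U
    unfolding \<nu>_def by (rule INF_lower) (use that in auto)
  have \<nu>D: "x \<le> \<nu> A" if "\<And>U. open U \<Longrightarrow> A \<subseteq> U \<Longrightarrow> x \<le> \<tau> U" for A x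
    unfolding \<nu>_def by (rule INF_greatest) (use that in auto)
  have \<nu>_open: "\<nu> U = \<tau> U" if "open U" for U
    by (rule antisym[OF \<nu>I \<nu>D]) (use that \<tau>_mono in auto)
  have \<nu>_mono: "\<nu> A \<le> \<nu> B" if "A \<subseteq> B" for A B
    by (rule \<nu>D) (use that in \<open>auto intro: \<nu>I\<close>)
  have \<nu>_le1: "\<nu> A \<le> 1" for A
    using \<nu>I[of UNIV A] \<tau>_le[of UNIV] mU by simp
  have \<nu>_approx: "\<exists>U. open U \<and> A \<subseteq> U \<and> \<tau> U \<le> \<nu> A + ennreal e" if "e > 0" for A e
  proof (rule ccontr)
    assume "\<not> ?thesis"
    then have "\<nu> A + ennreal e \<le> \<nu> A"
      by (intro \<nu>D) (auto simp: not_le intro: less_imp_le)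
    moreover have "\<nu> A \<noteq> top" using \<nu>_le1[of A] by (auto simp: top_unique)
    ultimately have "ennreal e \<le> 0"
      using ennreal_add_left_cancel_le[of "\<nu> A" "ennreal e" 0] by simp
    with that show False by simp
  qed
  have \<nu>_count: "\<nu> (\<Union>i. A i) \<le> (\<Sum>i. \<nu> (A i))" for A :: "nat \<Rightarrow> 'a set"
  proof (rule ennreal_le_epsilon)
    fix e :: real assume "e > 0"
    then have "\<exists>U. open U \<and> A i \<subseteq> U \<and> \<tau> U \<le> \<nu> (A i) + ennreal (e * (1/2)^Suc i)" for i
      by (intro \<nu>_approx) simp
    then obtain U where U: "\<And>i. open (U i)" "\<And>i. A i \<subseteq> U i"
      "\<And>i. \<tau> (U i) \<le> \<nu> (A i) + ennreal (e * (1/2)^Suc i)" by metis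
    have "\<nu> (\<Union>i. A i) \<le> \<tau> (\<Union>i. U i)"
      using U by (intro \<nu>I) (auto intro: open_UN)
    also have "\<dots> \<le> (\<Sum>i. \<tau> (U i))" using U(1) by (rule \<tau>_count)
    also have "\<dots> \<le> (\<Sum>i. \<nu> (A i) + ennreal (e * (1/2)^Suc i))"
      using U(3) by (intro suminf_le) auto
    also have "\<dots> = (\<Sum>i. \<nu> (A i)) + (\<Sum>i. ennreal (e * (1/2)^Suc i))"
      by (rule suminf_add[symmetric]) auto
    also have "(\<Sum>i. ennreal (e * (1/2)^Suc i)) = ennreal e"
      using \<open>e > 0\<close> sums_mult[OF power_half_series, of e] by (intro suminf_ennreal_eq) auto
    finally show "\<nu> (\<Union>i. A i) \<le> (\<Sum>i. \<nu> (A i)) + ennreal e" .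
  qed
  have "outer_measure_space (Pow UNIV) \<nu>"
    unfolding outer_measure_space_def positive_def increasing_def countably_subadditive_def
    using \<nu>_count \<nu>_mono \<nu>_open[of "{}"] \<tau>_empty by auto
  then have ms: "measure_space UNIV (lambda_system UNIV (Pow UNIV) \<nu>) \<nu>"
    by (rule sigma_algebra.caratheodory_lemma[OF sigma_algebra_Pow])
  \<comment> \<open>For an open \<open>V\<close> containing \<open>A\<close>, take a compact
    \<open>C\<close> in \<open>V \<inter> U\<close> and then a compact \<open>D\<close> in the open
    set \<open>V - C\<close>, both within \<open>K\<close>. They are disjoint, so
    \<open>m C + m D = m (C \<union> D) \<le> \<tau> V\<close>. Suprema over \<open>D\<close> and
    then over \<open>C\<close> give the splitting inequality.\<close>
  have open_in: "U \<in> lambda_system UNIV (Pow UNIV) \<nu>" if U: "open U" for U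
    unfolding algebra.lambda_system_eq[OF algebra_Pow]
  proof (intro CollectI conjI ballI antisym)
    fix A :: "'a set"
    show "\<nu> (A \<inter> U) + \<nu> (A - U) \<le> \<nu> A"
    proof (rule \<nu>D)
      fix V assume V: "open V" "A \<subseteq> V"
      have "\<tau> (V \<inter> U) + \<nu> (A - U) \<le> \<tau> V"
      proof (subst \<tau>_def, subst ennreal_SUP_add_left[symmetric])
        show "{C. compact C \<and> C \<subseteq> V \<inter> U \<inter> K} \<noteq> {}" by (auto intro!: exI[of _ "{}"])
        show "(SUP C\<in>{C. compact C \<and> C \<subseteq> V \<inter> U \<inter> K}. m C + \<nu> (A - U)) \<le> \<tau> V"
        proof (rule SUP_least, clarify)
          fix C assume C: "compact C" "C \<subseteq> V \<inter> U \<inter> K"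
          have "open (V - C)" using V C by (intro open_Diff compact_imp_closed) auto
          then have "m C + \<nu> (A - U) \<le> m C + \<tau> (V - C)"
            using V C by (intro add_left_mono \<nu>I) auto
          also have "\<dots> \<le> \<tau> V"
          proof (subst \<tau>_def, subst ennreal_SUP_add_right)
            show "{D. compact D \<and> D \<subseteq> (V - C) \<inter> K} \<noteq> {}" by (auto intro!: exI[of _ "{}"])
            show "(SUP D\<in>{D. compact D \<and> D \<subseteq> (V - C) \<inter> K}. m C + m D) \<le> \<tau> V"
            proof (rule SUP_least, clarify)
              fix D assume D: "compact D" "D \<subseteq> (V - C) \<inter> K"
              then have "m C + m D = m (C \<union> D)" by (intro add[symmetric]) auto
              also have "\<dots> \<le> \<tau> V" using C D by (intro \<tau>I compact_Un) auto
              finally show "m C + m D \<le> \<tau> V" .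
            qed
          qed
          finally show "m C + \<nu> (A - U) \<le> \<tau> V" .
        qed
      qed
      moreover have "\<nu> (A \<inter> U) \<le> \<tau> (V \<inter> U)" using V U by (intro \<nu>I) auto
      ultimately show "\<nu> (A \<inter> U) + \<nu> (A - U) \<le> \<tau> V"
        by (rule order_trans[OF add_right_mono, rotated])
    qed
    show "\<nu> A \<le> \<nu> (A \<inter> U) + \<nu> (A - U)"
    proof -
      let ?A = "\<lambda>i::nat. if i = 0 then A \<inter> U else if i = 1 then A - U else {}"
      have "\<nu> A \<le> \<nu> (\<Union>i. ?A i)"
        by (rule \<nu>_mono) (auto split: if_splits)
      also have "\<dots> \<le> (\<Sum>i. \<nu> (?A i))" by (rule \<nu>_count)
      also have "\<dots> = (\<Sum>i\<in>{0, 1}. \<nu> (?A i))"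
        by (rule suminf_finite) (auto simp: \<nu>_open \<tau>_empty)
      finally show ?thesis by simp
    qed
  qed auto
  have sa: "sigma_algebra UNIV (lambda_system UNIV (Pow UNIV) \<nu>)"
    using ms by (simp add: measure_space_def)
  have "sets borel \<subseteq> lambda_system UNIV (Pow UNIV) \<nu>"
  proof -
    have "sigma_sets UNIV {S. open S} \<subseteq> lambda_system UNIV (Pow UNIV) \<nu>"
      by (rule sigma_algebra.sigma_sets_subset[OF sa]) (use open_in in blast)
    then show ?thesis by (simp add: borel_def)
  qed
  with ms have msb: "measure_space UNIV (sets borel) \<nu>"
    using measure_down[OF ms, of "sets borel"] sets.sigma_algebra_axioms[of borel] by simp
  define M where "M = measure_of UNIV (sets borel) \<nu>"
  have sets_M: "sets M = sets borel"
    unfolding M_def by (simp add: sets.sigma_sets_eq[of borel, simplified])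
  then have space_M: "space M = UNIV" by (simp add: M_def)
  have M: "emeasure M A = \<nu> A" if "A \<in> sets borel" for A
    unfolding M_def
  proof (rule emeasure_measure_of_sigma)
    show "positive (sets borel) \<nu>" "countably_additive (sets borel) \<nu>"
      using msb by (auto simp: measure_space_def)
  qed (use that sets.sigma_algebra_axioms[of borel] in simp_all)
  have M_open: "emeasure M U = \<tau> U" if "open U" for U
    using M[of U] \<nu>_open that by simp
  have "\<tau> UNIV = 1"
    using \<tau>_le[of UNIV] \<tau>I[of K UNIV] K mU mK by (intro antisym) auto
  then have M1: "emeasure M UNIV = 1" by (simp add: M_open)
  then have "prob_space M"
    by (intro prob_spaceI) (simp add: space_M)
  then interpret M: prob_space M .
  have "emeasure M (- K) = 0"
  proof -
    have "\<tau> (- K) \<le> 0"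
    proof (rule \<tau>D)
      fix C assume "C \<subseteq> - K" "C \<subseteq> K"
      then have "C = {}" by auto
      then show "m C \<le> 0" using m_empty by simp
    qed
    then show ?thesis using K by (subst M_open) (auto simp: compact_imp_closed open_Compl)
  qed
  have "regular_borel_measure M"
    unfolding regular_borel_measure_def
  proof (intro conjI ballI sets_M)
    fix B :: "'a set" assume B: "B \<in> sets borel"
    have "emeasure M B = (INF U\<in>{U. open U \<and> B \<subseteq> U}. \<tau> U)"
      using M[OF B] by (simp add: \<nu>_def)
    also have "\<dots> = (INF U\<in>{U. B \<subseteq> U \<and> open U}. emeasure M U)"
      by (intro INF_cong) (auto simp: M_open)
    finally show "emeasure M B = (INF U\<in>{U. B \<subseteq> U \<and> open U}. emeasure M U)" .
    show "emeasure M B = (SUP C\<in>{C. C \<subseteq> B \<and> compact C}. emeasure M C)"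
    proof (rule antisym)
      show "(SUP C\<in>{C. C \<subseteq> B \<and> compact C}. emeasure M C) \<le> emeasure M B"
        using B by (intro SUP_least emeasure_mono) (auto simp: sets_M)
      show "emeasure M B \<le> (SUP C\<in>{C. C \<subseteq> B \<and> compact C}. emeasure M C)"
      proof (rule ennreal_le_epsilon)
        fix e :: real assume e: "e > 0"
        \<comment> \<open>Inner approximation of \<open>B\<close> comes from outer approximation of
          its complement: \<open>K - U\<close> is compact and contained in \<open>B\<close>. The
          part of \<open>B\<close> outside it lies in \<open>U\<close> or in the null set
          \<open>- K\<close>, which costs at most \<open>e\<close>.\<close>
        obtain U where U: "open U" "- B \<subseteq> U" "\<tau> U \<le> \<nu> (- B) + ennreal e"
          using \<nu>_approx[OF e] by blast
        let ?C = "K - U"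
        have C: "compact ?C" "?C \<subseteq> B" using K U by (auto intro: compact_diff)
        have UB: "U \<in> sets M" "- B \<in> sets M" "?C \<in> sets M" "B \<in> sets M" "- K \<in> sets M"
          using U B C K unfolding sets_M
          by (auto intro!: borel_open borel_closed compact_imp_closed open_Compl borel_comp)
        have "emeasure M B + emeasure M (- B) = 1"
          using plus_emeasure[OF UB(4,2)] M1 by simp
        also have "1 = emeasure M (?C \<union> (- K) \<union> U)"
        proof -
          have "?C \<union> (- K) \<union> U = UNIV" by auto
          then show ?thesis using M1 by simp
        qed
        also have "\<dots> \<le> emeasure M (?C \<union> (- K)) + emeasure M U"
          using UB by (intro emeasure_subadditive) auto
        also have "\<dots> \<le> emeasure M ?C + emeasure M (- K) + emeasure M U"
          using UB by (intro add_right_mono emeasure_subadditive) auto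
        also have "\<dots> \<le> emeasure M ?C + (emeasure M (- B) + ennreal e)"
          using U M[of "- B"] UB(2) \<open>emeasure M (- K) = 0\<close> by (simp add: M_open sets_M add_left_mono)
        finally have "emeasure M (- B) + emeasure M B \<le> emeasure M (- B) + (emeasure M ?C + ennreal e)"
          by (simp add: ac_simps)
        then have "emeasure M B \<le> emeasure M ?C + ennreal e"
          by (subst (asm) ennreal_add_left_cancel_le) auto
        also have "\<dots> \<le> (SUP C\<in>{C. C \<subseteq> B \<and> compact C}. emeasure M C) + ennreal e"
          using C by (intro add_right_mono SUP_upper) auto
        finally show "emeasure M B \<le> (SUP C\<in>{C. C \<subseteq> B \<and> compact C}. emeasure M C) + ennreal e" .
      qed
    qed
  qed
  moreover have "measure_support M \<subseteq> K"
  proof (rule subsetI, rule ccontr)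
    fix x assume x: "x \<in> measure_support M" "x \<notin> K"
    have "open (- K)" using K by (simp add: compact_imp_closed open_Compl)
    with x have "0 < emeasure M (- K)" unfolding measure_support_def by auto
    with \<open>emeasure M (- K) = 0\<close> show False by simp
  qed
  ultimately have "M \<in> prob_measures_on K"
    using \<open>prob_space M\<close> by (simp add: prob_measures_on_def)
  then show ?thesis using M_open \<tau>_le by (intro bexI[of _ M]) auto
qed

section \<open>Staircase approximation and exchange of integrals\<close>

text \<open>As \<open>h*h\<close> is finite, a bound on the integral of
  \<open>staircase h \<circ> g\<close> involves the measures of finitely many superlevel sets only, so it is a
  closed condition for setwise convergence, and superlevel sets of lower semicontinuous $g$ are open.\<close>

definition staircase :: "nat \<Rightarrow> ennreal \<Rightarrow> ennreal" where
  "staircase h z = (\<Sum>i=1..h*h. ennreal (1 / real h) * indicator {ennreal (real i / real h)<..} z)"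

text \<open>Only the indices in \<open>I\<close> contribute, each \<open>1 / h\<close>. There are at
  most \<open>Max I\<close> of them, and \<open>Max I / h\<close> is itself one of the thresholds
  lying below \<open>z\<close>.\<close>

lemma staircase_le: "staircase h z \<le> z"
proof -
  define I where "I = {i\<in>{1..h*h}. ennreal (real i / real h) < z}"
  have "staircase h z = (\<Sum>i\<in>I. ennreal (1 / real h))"
    unfolding staircase_def I_def
    by (intro sum.mono_neutral_cong_right) (auto simp: indicator_def)
  also have "\<dots> = ennreal (real (card I) / real h)"
    by (simp add: ennreal_of_nat_eq_real_of_nat flip: ennreal_mult')
  also have "\<dots> \<le> z"
  proof (cases "I = {}")
    case False
    have fin: "finite I" by (simp add: I_def)
    have "I \<subseteq> {1..Max I}" using fin by (auto simp: I_def)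
    then have "card I \<le> Max I" using card_mono[of "{1..Max I}" I] by simp
    then have "ennreal (real (card I) / real h) \<le> ennreal (real (Max I) / real h)"
      by (intro ennreal_leI divide_right_mono) auto
    also have "\<dots> \<le> z" using Max_in[OF fin False] by (auto simp: I_def)
    finally show ?thesis .
  qed simp
  finally show ?thesis .
qed

text \<open>For \<open>y < b < z\<close> all thresholds up to \<open>b\<close> count, and their
  contributions add up to more than \<open>b - 1/h\<close>. Since the staircases are not monotone in
  \<open>h\<close>, the limit inferior is the suitable form, to be combined with Fatou's
  lemma.\<close>

lemma le_liminf_staircase: "z \<le> liminf (\<lambda>h. staircase h z)"
  unfolding le_Liminf_iff
proof (intro allI impI)
  fix y assume "y < z"
  then obtain b where b: "y < b" "b < z" using dense by blast
  define \<beta> \<eta> where "\<beta> = enn2real b" "\<eta> = enn2real y"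
  have fin: "b < top" "y < top" using b by (auto simp: less_top[symmetric])
  have bb: "b = ennreal \<beta>" "y = ennreal \<eta>" using fin by (auto simp: \<beta>_\<eta>_def)
  have less: "0 \<le> \<eta>" "\<eta> < \<beta>" using b fin by (auto simp: \<beta>_\<eta>_def enn2real_less_iff)
  \<comment> \<open>The bound \<open>\<beta> < h\<close> keeps the needed indices below
    \<open>h * h\<close>; the other bound makes the mesh finer than
    \<open>\<beta> - \<eta>\<close>.\<close>
  have "\<forall>\<^sub>F h in sequentially. max \<beta> (1 / (\<beta> - \<eta>)) < real h"
    using filterlim_real_sequentially unfolding filterlim_at_top_dense by (rule spec)
  then show "\<forall>\<^sub>F h in sequentially. y < staircase h z"
  proof eventually_elim
    case (elim h)
    then have h: "\<beta> < real h" "1 / (\<beta> - \<eta>) < real h" "0 < real h" using less by auto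
    define j where "j = nat \<lfloor>\<beta> * real h\<rfloor>"
    have "0 \<le> \<beta> * real h" using less h by simp
    then have j: "real j \<le> \<beta> * real h" "\<beta> * real h - 1 < real j"
      unfolding j_def by linarith+
    have "real j \<le> real h * real h" using j(1) h mult_right_mono[of \<beta> "real h" "real h"] by linarith
    then have jh: "j \<le> h * h" by (metis of_nat_le_iff of_nat_mult)
    have "\<eta> * real h < \<beta> * real h - 1" using h(2,3) less by (simp add: field_simps)
    then have "\<eta> < real j / real h" using j(2) h(3) by (simp add: pos_less_divide_eq)
    then have "y < ennreal (real j / real h)" unfolding bb using less by (intro ennreal_lessI) auto
    also have "\<dots> = (\<Sum>i=1..j. ennreal (1 / real h))"
      by (simp add: ennreal_of_nat_eq_real_of_nat flip: ennreal_mult')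
    also have "\<dots> = (\<Sum>i=1..j. ennreal (1 / real h) * indicator {ennreal (real i / real h)<..} z)"
    proof (intro sum.cong refl)
      fix i assume i: "i \<in> {1..j}"
      then have "real i / real h \<le> \<beta>" using j h by (simp add: pos_divide_le_eq)
      then have "ennreal (real i / real h) < z" using b bb ennreal_leI by (metis le_less_trans)
      then show "ennreal (1 / real h) = ennreal (1 / real h) * indicator {ennreal (real i / real h)<..} z"
        by simp
    qed
    also have "\<dots> \<le> staircase h z"
      unfolding staircase_def using jh by (intro sum_mono2) auto
    finally show ?case .
  qed
qed

lemma measurable_staircase [measurable]: "staircase h \<in> borel_measurable borel"
  unfolding staircase_def[abs_def] by measurable

lemma nn_integral_staircase:
  assumes [measurable]: "g \<in> borel_measurable M" and sp: "space M = UNIV"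
  shows "(\<integral>\<^sup>+ y. staircase h (g y) \<partial>M) =
    (\<Sum>i=1..h*h. ennreal (1 / real h) * emeasure M {y. ennreal (real i / real h) < g y})"
proof -
  have "(\<integral>\<^sup>+ y. indicator {ennreal (real i / real h)<..} (g y) \<partial>M) =
      emeasure M {y. ennreal (real i / real h) < g y}" for i
  proof -
    have "{y. ennreal (real i / real h) < g y} = {y \<in> space M. ennreal (real i / real h) < g y}"
      by (simp add: sp)
    then have "{y. ennreal (real i / real h) < g y} \<in> sets M" by simp
    then have "emeasure M {y. ennreal (real i / real h) < g y} =
        (\<integral>\<^sup>+ y. indicator {y. ennreal (real i / real h) < g y} y \<partial>M)" by simp
    also have "\<dots> = (\<integral>\<^sup>+ y. indicator {ennreal (real i / real h)<..} (g y) \<partial>M)"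
      by (intro nn_integral_cong) (auto simp: indicator_def)
    finally show ?thesis by simp
  qed
  then have "(\<integral>\<^sup>+ y. ennreal (1 / real h) * indicator {ennreal (real i / real h)<..} (g y) \<partial>M) =
      ennreal (1 / real h) * emeasure M {y. ennreal (real i / real h) < g y}" for i
    by (subst nn_integral_cmult) auto
  then show ?thesis
    unfolding staircase_def by (subst nn_integral_sum) auto
qed

lemma nn_integral_le_if_staircase_le:
  assumes g [measurable]: "g \<in> borel_measurable M" and sp: "space M = UNIV"
    and le: "\<And>h::nat. (\<Sum>i=1..h*h. ennreal (1 / real h) * emeasure M {y. ennreal (real i / real h) < g y}) \<le> t"
  shows "(\<integral>\<^sup>+ y. g y \<partial>M) \<le> t"
proof -
  have "(\<integral>\<^sup>+ y. g y \<partial>M) \<le> (\<integral>\<^sup>+ y. liminf (\<lambda>h. staircase h (g y)) \<partial>M)"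
    by (intro nn_integral_mono le_liminf_staircase)
  also have "\<dots> \<le> liminf (\<lambda>h. \<integral>\<^sup>+ y. staircase h (g y) \<partial>M)"
    by (intro nn_integral_liminf) measurable
  also have "\<dots> \<le> liminf (\<lambda>h. t)"
    using le by (intro Liminf_mono always_eventually allI) (simp add: nn_integral_staircase[OF g sp])
  finally show ?thesis by (simp add: Liminf_const)
qed

section \<open>Semicontinuous kernels and the supports of regular measures\<close>

lemma lsc_measurable:
  assumes "lower_semicontinuous f"
  shows "f \<in> borel_measurable borel"
  using assms unfolding lower_semicontinuous_def
  by (intro borel_measurableI_greater) (auto intro: borel_open)

lemma open_superlevel:
  assumes "symmetric_lsc_kernel k"
  shows "open {y. a < k x y}"
proof -
  have "open ((\<lambda>y. (x, y)) -` {p. a < (\<lambda>(x, y). k x y) p})"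
    using assms unfolding symmetric_lsc_kernel_def lower_semicontinuous_def
    by (intro open_vimage) (auto intro!: continuous_intros)
  then show ?thesis by (simp add: vimage_def)
qed

lemma kernel_measurable:
  assumes "symmetric_lsc_kernel k"
  shows "k x \<in> borel_measurable borel"
  by (rule lsc_measurable) (use open_superlevel[OF assms] in \<open>simp add: lower_semicontinuous_def\<close>)

lemma prob_measures_onD:
  assumes "M \<in> prob_measures_on K"
  shows "prob_space M" "sets M = sets borel" "space M = UNIV"
    "\<And>B. B \<in> sets borel \<Longrightarrow> emeasure M B = (SUP C\<in>{C. C \<subseteq> B \<and> compact C}. emeasure M C)"
    "\<And>x. x \<notin> K \<Longrightarrow> \<exists>U. open U \<and> x \<in> U \<and> emeasure M U = 0"
proof -
  have M: "prob_space M" "regular_borel_measure M" "measure_support M \<subseteq> K"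
    using assms by (auto simp: prob_measures_on_def)
  show "prob_space M" by (rule M(1))
  show s: "sets M = sets borel"
    using M(2) unfolding regular_borel_measure_def by (rule conjunct1)
  show "emeasure M B = (SUP C\<in>{C. C \<subseteq> B \<and> compact C}. emeasure M C)" if "B \<in> sets borel" for B
    using M(2)[unfolded regular_borel_measure_def, THEN conjunct2, rule_format, OF that, THEN conjunct2] .
  show "space M = UNIV" using sets_eq_imp_space_eq[OF s] by simp
  show "\<exists>U. open U \<and> x \<in> U \<and> emeasure M U = 0" if "x \<notin> K" for x
  proof -
    have "x \<notin> measure_support M" using M(3) that by (rule contra_subsetD)
    then show ?thesis by (auto simp: measure_support_def not_less)
  qed
qed

text \<open>Every point outside \<open>K\<close> has a null neighbourhood, but uncountably many of
  these may be required to cover \<open>- K\<close>. Inner regularity reduces the claim to compact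
  subsets of \<open>- K\<close>, for which finitely many suffice.\<close>

lemma AE_in_support:
  fixes K :: "'a::t2_space set"
  assumes M: "M \<in> prob_measures_on K" and K: "compact K"
  shows "AE x in M. x \<in> K"
proof -
  note D = prob_measures_onD[OF M]
  have oK: "open (- K)" using K by (simp add: compact_imp_closed open_Compl)
  have "emeasure M C = 0" if C: "C \<subseteq> - K" "compact C" for C
  proof -
    have "\<forall>x\<in>C. \<exists>U. open U \<and> x \<in> U \<and> emeasure M U = 0" using C D(5) by blast
    then obtain U where U: "\<And>x. x \<in> C \<Longrightarrow> open (U x)" "\<And>x. x \<in> C \<Longrightarrow> x \<in> U x"
      "\<And>x. x \<in> C \<Longrightarrow> emeasure M (U x) = 0" by metis
    obtain F where F: "F \<subseteq> C" "finite F" "C \<subseteq> (\<Union>x\<in>F. U x)"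
      by (rule compactE_image[OF C(2), of C U]) (use U in auto)
    have UF: "U x \<in> sets M" if "x \<in> F" for x using F U that by (auto simp: D(2))
    then have "emeasure M C \<le> emeasure M (\<Union>x\<in>F. U x)"
      using F by (intro emeasure_mono sets.finite_UN) auto
    also have "\<dots> \<le> (\<Sum>x\<in>F. emeasure M (U x))"
      using UF F by (intro emeasure_subadditive_finite) auto
    also have "\<dots> = 0" using U(3) F by (auto intro!: sum.neutral)
    finally show ?thesis by simp
  qed
  then have "(SUP C\<in>{C. C \<subseteq> - K \<and> compact C}. emeasure M C) \<le> 0" by (intro SUP_least) simp
  then have "emeasure M (- K) = 0" using D(4)[of "- K"] oK by simp
  then show ?thesis
    using oK by (intro AE_I[of _ _ "- K"]) (auto simp: D)
qed

text \<open>Chooses near-maximizers for all summands at once. The accumulator \<open>a\<close>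
  carries the summands already fixed, so each step exchanges a single supremum.\<close>

lemma less_sum_SUP:
  fixes g :: "'i \<Rightarrow> 'c \<Rightarrow> ennreal"
  assumes "finite I" "\<And>i. \<C> i \<noteq> {}" "s < a + (\<Sum>i\<in>I. SUP c\<in>\<C> i. g i c)"
  shows "\<exists>c. (\<forall>i\<in>I. c i \<in> \<C> i) \<and> s < a + (\<Sum>i\<in>I. g i (c i))"
  using assms(1,3)
proof (induction I arbitrary: a)
  case (insert j I)
  have "s < (SUP c\<in>\<C> j. g j c) + (a + (\<Sum>i\<in>I. SUP c\<in>\<C> i. g i c))"
    using insert.prems insert.hyps by (simp add: ac_simps)
  also have "\<dots> = (SUP c\<in>\<C> j. g j c + (a + (\<Sum>i\<in>I. SUP c\<in>\<C> i. g i c)))"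
    using ennreal_SUP_add_left[OF assms(2)] by simp
  finally obtain d where d: "d \<in> \<C> j" "s < g j d + (a + (\<Sum>i\<in>I. SUP c\<in>\<C> i. g i c))"
    unfolding less_SUP_iff by blast
  then have "s < (g j d + a) + (\<Sum>i\<in>I. SUP c\<in>\<C> i. g i c)" by (simp add: add.assoc)
  from insert.IH[OF this] obtain c where c: "\<And>i. i \<in> I \<Longrightarrow> c i \<in> \<C> i" "s < (g j d + a) + (\<Sum>i\<in>I. g i (c i))"
    by blast
  have "(\<Sum>i\<in>I. g i ((c(j := d)) i)) = (\<Sum>i\<in>I. g i (c i))"
    using insert.hyps by (intro sum.cong) auto
  then have "s < a + (\<Sum>i\<in>insert j I. g i ((c(j := d)) i))"
    using c(2) insert.hyps by (simp add: ac_simps)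
  then show ?case using c(1) d(1) by (intro exI[of _ "c(j := d)"]) auto
qed simp

section \<open>Product-measurable minorants and the Fubini inequality\<close>

lemma tube:
  fixes W :: "('a::topological_space \<times> 'b::topological_space) set"
  assumes "open W" "compact C" "{x} \<times> C \<subseteq> W"
  shows "\<exists>V. open V \<and> x \<in> V \<and> V \<times> C \<subseteq> W"
proof -
  have "openin (prod_topology euclidean euclidean) W"
    using assms(1) by (simp add: prod_topology_euclidean)
  from tube_lemma_right[OF this, of C x] assms(2,3) obtain U V where
    "open U" "x \<in> U" "C \<subseteq> V" "U \<times> V \<subseteq> W"
    by auto
  then show ?thesis by (intro exI[of _ U]) blast
qed

text \<open>Some staircase of \<open>k x\<close> still has integral above \<open>s\<close>, and by
  inner regularity its superlevel sets may be shrunk to compact sets \<open>C i\<close>. The tube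
  lemma spreads \<open>k > i / h\<close> from \<open>{x} \<times> C i\<close> to a neighbourhood of
  \<open>x\<close>, so there the step function built on the \<open>C i\<close> stays below a
  staircase of \<open>k z\<close>, hence below \<open>k z\<close>.\<close>

lemma kernel_local_minorant:
  fixes k :: "'a::t2_space \<Rightarrow> 'a \<Rightarrow> ennreal"
  assumes k: "symmetric_lsc_kernel k" and M: "M \<in> prob_measures_on K" and s: "s < potential k M x"
  shows "\<exists>V u. open V \<and> x \<in> V \<and> u \<in> borel_measurable borel \<and> s < (\<integral>\<^sup>+ y. u y \<partial>M) \<and>
    (\<forall>z\<in>V. \<forall>y. u y \<le> k z y)"
proof -
  note D = prob_measures_onD[OF M]
  have km: "k x \<in> borel_measurable M" using kernel_measurable[OF k] by (simp add: measurable_cong_sets[OF D(2) refl])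
  obtain h :: nat where h: "s < (\<Sum>i=1..h*h. ennreal (1 / real h) * emeasure M {y. ennreal (real i / real h) < k x y})"
    using nn_integral_le_if_staircase_le[OF km D(3), of s] s by (auto simp: potential_def not_le[symmetric])
  let ?C = "\<lambda>i. {C. C \<subseteq> {y. ennreal (real i / real h) < k x y} \<and> compact C}"
  have "ennreal (1 / real h) * emeasure M {y. ennreal (real i / real h) < k x y} =
      (SUP C\<in>?C i. ennreal (1 / real h) * emeasure M C)" for i
    using D(4)[OF borel_open[OF open_superlevel[OF k]]] by (simp add: SUP_mult_left_ennreal)
  then have ls: "s < 0 + (\<Sum>i=1..h*h. SUP C\<in>?C i. ennreal (1 / real h) * emeasure M C)"
    using h by simp
  obtain C where
    C: "\<And>i. i \<in> {1..h*h} \<Longrightarrow> C i \<in> ?C i" "s < (\<Sum>i=1..h*h. ennreal (1 / real h) * emeasure M (C i))"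
  proof -
    have "{} \<in> ?C i" for i by simp
    then have ne: "?C i \<noteq> {}" for i by (rule ex_in_conv[THEN iffD1, OF exI])
    have "\<exists>c. (\<forall>i\<in>{1..h*h}. c i \<in> ?C i) \<and> s < 0 + (\<Sum>i=1..h*h. ennreal (1 / real h) * emeasure M (c i))"
      by (rule less_sum_SUP[OF finite_atLeastAtMost ne ls])
    then obtain C where
      "\<forall>i\<in>{1..h*h}. C i \<in> ?C i" "s < 0 + (\<Sum>i=1..h*h. ennreal (1 / real h) * emeasure M (C i))"
      by (elim exE conjE)
    then show ?thesis by (intro that) auto
  qed
  have "\<exists>V. open V \<and> x \<in> V \<and> V \<times> C i \<subseteq> {p. ennreal (real i / real h) < (\<lambda>(x, y). k x y) p}"
    if "i \<in> {1..h*h}" for i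
    using C(1)[OF that] k unfolding symmetric_lsc_kernel_def lower_semicontinuous_def
    by (intro tube) auto
  then obtain V where V: "\<And>i. i \<in> {1..h*h} \<Longrightarrow> open (V i)" "\<And>i. i \<in> {1..h*h} \<Longrightarrow> x \<in> V i"
    "\<And>i z y. i \<in> {1..h*h} \<Longrightarrow> z \<in> V i \<Longrightarrow> y \<in> C i \<Longrightarrow> ennreal (real i / real h) < k z y"
    by (simp add: subset_iff) metis
  let ?u = "\<lambda>y. \<Sum>i=1..h*h. ennreal (1 / real h) * indicator (C i) y"
  have Cm: "C i \<in> sets borel" if "i \<in> {1..h*h}" for i
    using C(1)[OF that] by (auto intro: borel_closed compact_imp_closed)
  show ?thesis
  proof (intro exI[of _ "\<Inter>i\<in>{1..h*h}. V i"] exI[of _ ?u] conjI ballI allI)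
    show "open (\<Inter>i\<in>{1..h*h}. V i)" using V(1) by (intro open_INT) auto
    show "x \<in> (\<Inter>i\<in>{1..h*h}. V i)" using V(2) by blast
    show "?u \<in> borel_measurable borel"
      using Cm by (intro borel_measurable_sum borel_measurable_times_ennreal) auto
    have "(\<integral>\<^sup>+ y. ?u y \<partial>M) = (\<Sum>i=1..h*h. ennreal (1 / real h) * emeasure M (C i))"
    proof (subst nn_integral_sum)
      fix i assume "i \<in> {1..h*h}"
      then have [measurable]: "C i \<in> sets M" using Cm D(2) by blast
      show "(\<lambda>y. ennreal (1 / real h) * indicator (C i) y) \<in> borel_measurable M" by measurable
    next
      have "(\<integral>\<^sup>+ y. ennreal (1 / real h) * indicator (C i) y \<partial>M) = ennreal (1 / real h) * emeasure M (C i)"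
        if "i \<in> {1..h*h}" for i
        using Cm[OF that] D(2) by (intro nn_integral_cmult_indicator) simp
      then show "(\<Sum>i=1..h*h. \<integral>\<^sup>+ y. ennreal (1 / real h) * indicator (C i) y \<partial>M) =
          (\<Sum>i=1..h*h. ennreal (1 / real h) * emeasure M (C i))"
        by (rule sum.cong[OF refl])
    qed
    then show "s < (\<integral>\<^sup>+ y. ?u y \<partial>M)" using C(2) by simp
    fix z y assume "z \<in> (\<Inter>i\<in>{1..h*h}. V i)"
    then have "?u y \<le> staircase h (k z y)"
      unfolding staircase_def using V(3)[of _ z y]
      by (intro sum_mono mult_left_mono) (auto simp: indicator_def)
    also have "\<dots> \<le> k z y" by (rule staircase_le)
    finally show "?u y \<le> k z y" .
  qed
qed

text \<open>Taking \<open>s\<close> strictly below the left side leaves room to replace the kernel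
  near each point of \<open>K\<close> by a local minorant whose \<open>M\<close>-integral still
  exceeds \<open>s\<close>.\<close>

lemma INF_potential_le_SUP_potential:
  fixes k :: "'a::t2_space \<Rightarrow> 'a \<Rightarrow> ennreal"
  assumes k: "symmetric_lsc_kernel k" and K: "compact K"
    and M: "M \<in> prob_measures_on K" and N: "N \<in> prob_measures_on K"
  shows "(INF x\<in>K. potential k M x) \<le> (SUP x\<in>K. potential k N x)"
proof (rule dense_le)
  fix s assume s: "s < (INF x\<in>K. potential k M x)"
  note DM = prob_measures_onD[OF M] and DN = prob_measures_onD[OF N]
  interpret M: prob_space M by (rule DM(1))
  interpret N: prob_space N by (rule DN(1))
  interpret P: pair_sigma_finite N M ..
  have "s < potential k M x" if "x \<in> K" for x
    using s INF_lower[OF that, of "potential k M"] by (rule less_le_trans)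
  then have "\<forall>x\<in>K. \<exists>V u. open V \<and> x \<in> V \<and> u \<in> borel_measurable borel \<and> s < (\<integral>\<^sup>+ y. u y \<partial>M) \<and>
      (\<forall>z\<in>V. \<forall>y. u y \<le> k z y)"
    using kernel_local_minorant[OF k M] by blast
  then obtain V u where V: "\<And>x. x \<in> K \<Longrightarrow> open (V x)" "\<And>x. x \<in> K \<Longrightarrow> x \<in> V x"
    and u: "\<And>x. x \<in> K \<Longrightarrow> u x \<in> borel_measurable borel" "\<And>x. x \<in> K \<Longrightarrow> s < (\<integral>\<^sup>+ y. u x y \<partial>M)"
      "\<And>x z y. x \<in> K \<Longrightarrow> z \<in> V x \<Longrightarrow> u x y \<le> k z y"
    by metis
  obtain F where F: "F \<subseteq> K" "finite F" "K \<subseteq> (\<Union>x\<in>F. V x)"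
    by (rule compactE_image[OF K, of K V]) (use V in auto)
  \<comment> \<open>Each term is a product of functions of one variable, so \<open>q\<close> is
    measurable for the product sigma-algebra and Fubini applies to it.\<close>
  define q where "q x y = (SUP c\<in>F. indicator (V c) x * u c y)" for x y
  have qk: "q x y \<le> k x y" for x y
    unfolding q_def using u(3) F by (intro SUP_least) (auto simp: indicator_def)
  have "case_prod q \<in> borel_measurable (N \<Otimes>\<^sub>M M)"
  proof -
    have "(\<lambda>p. SUP c\<in>F. indicator (V c) (fst p) * u c (snd p)) \<in> borel_measurable (N \<Otimes>\<^sub>M M)"
    proof (intro borel_measurable_SUP borel_measurable_times_ennreal)
      fix c assume "c \<in> F"
      then have c: "c \<in> K" using F by auto
      have "V c \<in> sets N" using V(1)[OF c] by (simp add: DN(2))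
      then have "(indicator (V c) :: 'a \<Rightarrow> ennreal) \<in> borel_measurable N" by (rule borel_measurable_indicator)
      then show "(\<lambda>p. indicator (V c) (fst p) :: ennreal) \<in> borel_measurable (N \<Otimes>\<^sub>M M)"
        by (rule measurable_compose[OF measurable_fst])
      have "u c \<in> borel_measurable M"
        using u(1)[OF c] by (simp add: measurable_cong_sets[OF DM(2) refl])
      then show "(\<lambda>p. u c (snd p)) \<in> borel_measurable (N \<Otimes>\<^sub>M M)"
        by (rule measurable_compose[OF measurable_snd])
    qed (use F countable_finite in auto)
    then show ?thesis by (simp add: q_def[abs_def] case_prod_beta')
  qed
  note Fub = P.Fubini'[OF this]
  have "s = (\<integral>\<^sup>+ x. s \<partial>N)" by (simp add: N.emeasure_space_1)
  also have "\<dots> \<le> (\<integral>\<^sup>+ x. (\<integral>\<^sup>+ y. q x y \<partial>M) \<partial>N)"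
  proof (rule nn_integral_mono_AE)
    show "AE x in N. s \<le> (\<integral>\<^sup>+ y. q x y \<partial>M)"
      using AE_in_support[OF N K]
    proof eventually_elim
      case (elim x)
      then obtain c where c: "c \<in> F" "x \<in> V c" using F by blast
      have "u c y \<le> q x y" for y
        unfolding q_def by (rule SUP_upper2[OF c(1)]) (use c in simp)
      then have "(\<integral>\<^sup>+ y. u c y \<partial>M) \<le> (\<integral>\<^sup>+ y. q x y \<partial>M)" by (intro nn_integral_mono)
      moreover have "s < (\<integral>\<^sup>+ y. u c y \<partial>M)" using c F u(2) by auto
      ultimately show ?case by simp
    qed
  qed
  also have "\<dots> = (\<integral>\<^sup>+ y. (\<integral>\<^sup>+ x. q x y \<partial>N) \<partial>M)" by (rule Fub[symmetric])
  \<comment> \<open>From here on only monotonicity of the integral is applied, which holds for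
    arbitrary nonnegative functions.\<close>
  also have "\<dots> \<le> (\<integral>\<^sup>+ y. (\<integral>\<^sup>+ x. k x y \<partial>N) \<partial>M)" by (intro nn_integral_mono qk)
  also have "\<dots> = (\<integral>\<^sup>+ y. potential k N y \<partial>M)"
    using k by (simp add: potential_def symmetric_lsc_kernel_def)
  also have "\<dots> \<le> (\<integral>\<^sup>+ y. (SUP x\<in>K. potential k N x) \<partial>M)"
  proof (rule nn_integral_mono_AE)
    show "AE y in M. potential k N y \<le> (SUP x\<in>K. potential k N x)"
      using AE_in_support[OF M K] by eventually_elim (rule SUP_upper)
  qed
  also have "\<dots> = (SUP x\<in>K. potential k N x)" by (simp add: M.emeasure_space_1)
  finally show "s \<le> (SUP x\<in>K. potential k N x)" .
qed

section \<open>Existence of extremal measures and the rendezvous theorem\<close>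

lemma ennreal_of_nat_average:
  fixes a :: "nat \<Rightarrow> real"
  assumes "n \<ge> 1" "\<And>j. 0 \<le> a j"
  shows "ennreal ((\<Sum>j=1..n. a j) / real n) = (\<Sum>j=1..n. ennreal (a j)) / of_nat n"
  using assms by (simp add: ennreal_of_nat_eq_real_of_nat divide_ennreal sum_nonneg)

lemma sum_div_ennreal:
  fixes f :: "'i \<Rightarrow> ennreal"
  shows "(\<Sum>i\<in>I. f i / c) = (\<Sum>i\<in>I. f i) / c"
  by (simp add: divide_ennreal_def sum_distrib_right)

lemma ennreal_scaled_sum:
  fixes f :: "'i \<Rightarrow> real"
  assumes "0 \<le> c" "\<And>i. 0 \<le> f i"
  shows "ennreal (\<Sum>i\<in>I. c * f i) = (\<Sum>i\<in>I. ennreal c * ennreal (f i))"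
  using assms by (subst sum_ennreal[symmetric]) (auto simp: ennreal_mult)

text \<open>Set functions with values in \<open>{0..1}\<close> form a compact product space, and
  each condition in \<open>\<Phi> x\<close> involves finitely many coordinates, so it is closed. The
  averages of point masses supplied by \<open>fin\<close> give the finite intersection property. The
  common element \<open>m\<close> is only finitely additive, but the regular measure below it on
  open sets inherits the bounds.\<close>

lemma potential_le_by_compactness:
  fixes k :: "'a::t2_space \<Rightarrow> 'a \<Rightarrow> ennreal"
  assumes k: "symmetric_lsc_kernel k" and K: "compact K" "K \<noteq> {}"
    and fin: "\<And>F. finite F \<Longrightarrow> F \<noteq> {} \<Longrightarrow> F \<subseteq> K \<Longrightarrow>
      \<exists>n\<ge>1. \<exists>v. (\<forall>j\<in>{1..n}. v j \<in> K) \<and> (\<forall>x\<in>F. (\<Sum>j=1..n. k x (v j)) / of_nat n \<le> t)"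
  shows "\<exists>M\<in>prob_measures_on K. \<forall>x\<in>K. potential k M x \<le> t"
proof -
  define S where "S = PiE (UNIV :: 'a set set) (\<lambda>_. {0..1::real})"
  define L where "L h i x = {y. ennreal (real i / real h) < k x y}" for h i :: nat and x
  define \<Phi> where "\<Phi> x = {m :: 'a set \<Rightarrow> real. (\<forall>A B. A \<inter> B = {} \<longrightarrow> m (A \<union> B) = m A + m B) \<and>
      m UNIV = 1 \<and> m K = 1 \<and> (\<forall>h. ennreal (\<Sum>i=1..h*h. 1 / real h * m (L h i x)) \<le> t)}" for x
  have "compactin (product_topology (\<lambda>_. euclidean) UNIV) S"
    unfolding S_def compactin_PiE by simp
  then have "compact S" by (simp add: euclidean_product_topology)
  moreover have "closed (\<Phi> x)" for x
    unfolding \<Phi>_def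
    by (intro closed_Collect_conj closed_Collect_all closed_Collect_imp closed_Collect_eq closed_Collect_le
        open_Collect_const continuous_intros continuous_on_ennreal continuous_on_product_coordinates)
  moreover have "S \<inter> (\<Inter>x\<in>F. \<Phi> x) \<noteq> {}" if F: "finite F" "F \<subseteq> K" for F
  proof -
    \<comment> \<open>The finite intersection property includes \<open>F = {}\<close>, whereas
      \<open>fin\<close> asks for a nonempty set.\<close>
    obtain x0 where x0: "x0 \<in> K" using K(2) by blast
    have "finite (insert x0 F)" "insert x0 F \<noteq> {}" "insert x0 F \<subseteq> K" using F x0 by auto
    from fin[OF this] obtain n v where n: "n \<ge> 1" and v: "\<forall>j\<in>{1..n}. v j \<in> K"
      and le: "\<forall>x\<in>insert x0 F. (\<Sum>j=1..n. k x (v j)) / of_nat n \<le> t"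
      by (elim exE conjE)
    define m :: "'a set \<Rightarrow> real" where "m A = (\<Sum>j=1..n. indicator A (v j)) / real n" for A
    have em: "ennreal (m A) = (\<Sum>j=1..n. indicator A (v j)) / of_nat n" for A
      unfolding m_def using n by (subst ennreal_of_nat_average) (auto simp: ennreal_indicator)
    have "m A \<le> 1" for A
    proof -
      have "(\<Sum>j=1..n. indicator A (v j)) \<le> (\<Sum>j=1..n. 1::real)"
        by (intro sum_mono) (auto simp: indicator_def)
      then show ?thesis using n by (simp add: m_def)
    qed
    moreover have m0: "0 \<le> m A" for A by (simp add: m_def sum_nonneg)
    ultimately have "m \<in> S" by (auto simp: S_def)
    moreover have "m \<in> \<Phi> x" if x: "x \<in> F" for x
      unfolding \<Phi>_def
    proof (intro CollectI conjI allI impI)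
      fix A B :: "'a set" assume "A \<inter> B = {}"
      then have "indicator (A \<union> B) y = (indicator A y + indicator B y :: real)" for y
        by (auto simp: indicator_def)
      then show "m (A \<union> B) = m A + m B"
        by (simp add: m_def sum.distrib add_divide_distrib)
    next
      show "m UNIV = 1" using n by (simp add: m_def)
      have "(\<Sum>j=1..n. indicator K (v j)) = (\<Sum>j=1..n. 1::real)"
        using v by (intro sum.cong) auto
      then show "m K = 1" using n by (simp add: m_def)
    next
      fix h
      \<comment> \<open>For an average of point masses, exchanging the two sums produces the average
        of \<open>staircase h (k x (v j))\<close>, which is at most that of the kernel.\<close>
      have "ennreal (\<Sum>i=1..h*h. 1 / real h * m (L h i x)) =
          (\<Sum>i=1..h*h. ennreal (1 / real h) * ((\<Sum>j=1..n. indicator (L h i x) (v j)) / of_nat n))"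
        unfolding em[symmetric] using m0 by (intro ennreal_scaled_sum) auto
      also have "\<dots> = (\<Sum>i=1..h*h. (\<Sum>j=1..n. ennreal (1 / real h) * indicator (L h i x) (v j))) / of_nat n"
        unfolding sum_div_ennreal[symmetric] by (simp add: ennreal_times_divide sum_distrib_left)
      also have "(\<Sum>i=1..h*h. (\<Sum>j=1..n. ennreal (1 / real h) * indicator (L h i x) (v j))) =
          (\<Sum>j=1..n. staircase h (k x (v j)))"
        unfolding staircase_def L_def by (subst sum.swap) (auto simp: indicator_def intro!: sum.cong)
      also have "\<dots> / of_nat n \<le> (\<Sum>j=1..n. k x (v j)) / of_nat n"
        by (intro divide_right_mono_ennreal sum_mono staircase_le)
      also have "\<dots> \<le> t" using le x by blast
      finally show "ennreal (\<Sum>i=1..h*h. 1 / real h * m (L h i x)) \<le> t" .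
    qed
    ultimately show ?thesis by blast
  qed
  ultimately have "S \<inter> (\<Inter>x\<in>K. \<Phi> x) \<noteq> {}" by (rule compact_imp_fip_image)
  then obtain m where mS: "m \<in> S" and m: "\<And>x. x \<in> K \<Longrightarrow> m \<in> \<Phi> x" by blast
  have m0: "0 \<le> m A" for A using mS by (auto simp: S_def)
  obtain x0 where "x0 \<in> K" using K(2) by blast
  \<comment> \<open>Additivity and the two normalizations do not depend on the point, so membership
    in one \<open>\<Phi> x\<close> supplies them.\<close>
  note m' = m[OF this, unfolded \<Phi>_def mem_Collect_eq]
  have "\<exists>M\<in>prob_measures_on K. \<forall>U. open U \<longrightarrow> emeasure M U \<le> ennreal (m U)"
    using m' m0 by (intro additive_probability_le_regular_measure[OF K(1)]) (auto simp: ennreal_plus)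
  then obtain M where M: "M \<in> prob_measures_on K" "\<And>U. open U \<Longrightarrow> emeasure M U \<le> ennreal (m U)"
    by blast
  note D = prob_measures_onD[OF M(1)]
  have "potential k M x \<le> t" if x: "x \<in> K" for x
    unfolding potential_def
  proof (rule nn_integral_le_if_staircase_le)
    show "k x \<in> borel_measurable M"
      using kernel_measurable[OF k] by (simp add: measurable_cong_sets[OF D(2) refl])
    show "space M = UNIV" by (rule D(3))
    fix h
    \<comment> \<open>The comparison of \<open>M\<close> with \<open>m\<close> is available because
      the superlevel sets of the kernel are open.\<close>
    have "(\<Sum>i=1..h*h. ennreal (1 / real h) * emeasure M (L h i x)) \<le>
        (\<Sum>i=1..h*h. ennreal (1 / real h) * ennreal (m (L h i x)))"
      unfolding L_def by (intro sum_mono mult_left_mono M(2) open_superlevel[OF k]) simp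
    also have "\<dots> = ennreal (\<Sum>i=1..h*h. 1 / real h * m (L h i x))"
      using m0 by (intro ennreal_scaled_sum[symmetric]) auto
    also have "\<dots> \<le> t" using m[OF x] by (simp add: \<Phi>_def)
    finally show "(\<Sum>i=1..h*h. ennreal (1 / real h) * emeasure M {y. ennreal (real i / real h) < k x y}) \<le> t"
      unfolding L_def .
  qed
  with M(1) show ?thesis by blast
qed

text \<open>Makes finite averages of the kernel potentials of admissible measures. The measure of a
  Borel set \<open>B\<close> depends only on its trace on the finite set \<open>?W\<close>; thus the
  open set \<open>- (?W - B)\<close> and the compact set \<open>B \<inter> ?W\<close> have the same
  measure as \<open>B\<close>, which gives regularity.\<close>

lemma average_measure:
  fixes w :: "nat \<Rightarrow> 'a::t2_space"
  assumes n: "n \<ge> 1" and w: "\<And>j. j \<in> {1..n} \<Longrightarrow> w j \<in> K"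
  shows "\<exists>M\<in>prob_measures_on K. \<forall>f\<in>borel_measurable borel.
    (\<integral>\<^sup>+ y. f y \<partial>M) = (\<Sum>j=1..n. f (w j)) / of_nat n"
proof -
  define M where "M = distr (uniform_count_measure {1..n}) borel w"
  have wm: "w \<in> measurable (uniform_count_measure {1..n}) borel"
    by (simp add: measurable_def space_uniform_count_measure sets_uniform_count_measure)
  have sM: "sets M = sets borel" by (simp add: M_def)
  have "prob_space (uniform_count_measure {1..n})" using n by (intro prob_space_uniform_count_measure) auto
  then have "prob_space M" unfolding M_def using wm by (rule prob_space.prob_space_distr)
  have int: "(\<integral>\<^sup>+ y. f y \<partial>M) = (\<Sum>j=1..n. f (w j)) / of_nat n" if "f \<in> borel_measurable borel" for f
  proof -
    have "(\<integral>\<^sup>+ y. f y \<partial>M) = (\<integral>\<^sup>+ j. f (w j) \<partial>uniform_count_measure {1..n})"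
      unfolding M_def by (rule nn_integral_distr) (use wm that in auto)
    also have "\<dots> = (\<Sum>j=1..n. f (w j) * ennreal (1 / real n))"
      unfolding uniform_count_measure_def by (subst nn_integral_point_measure_finite) (auto simp: ac_simps)
    also have "\<dots> = (\<Sum>j=1..n. f (w j)) / of_nat n"
      using n by (simp add: divide_ennreal_def inverse_ennreal ennreal_of_nat_eq_real_of_nat divide_inverse
          flip: sum_distrib_right)
    finally show ?thesis .
  qed
  have em: "emeasure M B = (\<Sum>j=1..n. indicator B (w j)) / of_nat n" if "B \<in> sets borel" for B
  proof -
    have "emeasure M B = (\<integral>\<^sup>+ y. indicator B y \<partial>M)" using that sM by simp
    also have "\<dots> = (\<Sum>j=1..n. indicator B (w j)) / of_nat n" using that by (intro int) simp
    finally show ?thesis .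
  qed
  let ?W = "w ` {1..n}"
  have fin: "closed C" "compact C" if "C \<subseteq> ?W" for C
    using finite_subset[OF that] by (auto intro: finite_imp_closed finite_imp_compact)
  have eq: "emeasure M A = emeasure M B"
    if "A \<in> sets borel" "B \<in> sets borel" "A \<inter> ?W = B \<inter> ?W" for A B
  proof -
    have "indicator A (w j) = (indicator B (w j) :: ennreal)" if "j \<in> {1..n}" for j
      using that \<open>A \<inter> ?W = B \<inter> ?W\<close> by (auto simp: indicator_def)
    then show ?thesis using that by (simp add: em)
  qed
  have "regular_borel_measure M"
    unfolding regular_borel_measure_def
  proof (intro conjI ballI sM)
    fix B :: "'a set" assume B: "B \<in> sets borel"
    show "emeasure M B = (INF U\<in>{U. B \<subseteq> U \<and> open U}. emeasure M U)"
    proof (rule antisym)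
      show "emeasure M B \<le> (INF U\<in>{U. B \<subseteq> U \<and> open U}. emeasure M U)"
        by (intro INF_greatest emeasure_mono) (auto simp: sM)
      have oU: "open (- (?W - B))" by (intro open_Compl fin(1)) auto
      then have "(INF U\<in>{U. B \<subseteq> U \<and> open U}. emeasure M U) \<le> emeasure M (- (?W - B))"
        by (intro INF_lower) auto
      also have "\<dots> = emeasure M B" by (rule eq[OF borel_open[OF oU] B]) blast
      finally show "(INF U\<in>{U. B \<subseteq> U \<and> open U}. emeasure M U) \<le> emeasure M B" .
    qed
    show "emeasure M B = (SUP C\<in>{C. C \<subseteq> B \<and> compact C}. emeasure M C)"
    proof (rule antisym)
      show "(SUP C\<in>{C. C \<subseteq> B \<and> compact C}. emeasure M C) \<le> emeasure M B"
        using B by (intro SUP_least emeasure_mono) (auto simp: sM)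
      have "emeasure M B = emeasure M (B \<inter> ?W)" by (rule eq[OF B borel_closed[OF fin(1)]]) blast+
      also have "\<dots> \<le> (SUP C\<in>{C. C \<subseteq> B \<and> compact C}. emeasure M C)"
        using fin(2)[of "B \<inter> ?W"] by (intro SUP_upper) auto
      finally show "emeasure M B \<le> (SUP C\<in>{C. C \<subseteq> B \<and> compact C}. emeasure M C)" .
    qed
  qed
  moreover have "measure_support M \<subseteq> K"
  proof (rule subsetI, rule ccontr)
    fix x assume x: "x \<in> measure_support M" "x \<notin> K"
    have o: "open (- ?W)" using fin(1)[of ?W] by (auto intro: open_Compl)
    moreover have "x \<in> - ?W" using x(2) w by auto
    ultimately have "0 < emeasure M (- ?W)" using x(1) unfolding measure_support_def by blast
    moreover have "emeasure M (- ?W) = emeasure M {}" using o by (intro eq borel_open) auto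
    ultimately show False by simp
  qed
  ultimately have "M \<in> prob_measures_on K"
    using \<open>prob_space M\<close> by (simp add: prob_measures_on_def)
  then show ?thesis using int by blast
qed

text \<open>By the tube lemma, \<open>k x y < k c y + e\<close> holds for all \<open>y\<close> in
  \<open>K\<close> at once when \<open>x\<close> is near \<open>c\<close>; finitely many such
  neighbourhoods cover \<open>K\<close>.\<close>

lemma continuous_kernel_finite_net:
  fixes k :: "'a::t2_space \<Rightarrow> 'a \<Rightarrow> ennreal"
  assumes k: "continuous_kernel k" and K: "compact K" and e: "e > 0"
  shows "\<exists>F\<subseteq>K. finite F \<and> (\<forall>x\<in>K. \<exists>c\<in>F. \<forall>y\<in>K. k x y \<le> k c y + e)"
proof -
  have c: "continuous_on UNIV (\<lambda>(x, y). k x y)" and f: "\<And>x y. k x y < top"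
    using k by (auto simp: continuous_kernel_def)
  have "\<exists>V. open V \<and> c \<in> V \<and> V \<times> K \<subseteq> {p. k (fst p) (snd p) < k c (snd p) + e}" for c
  proof (rule tube[OF _ K])
    have c': "continuous_on UNIV (\<lambda>p::'a \<times> 'a. k (fst p) (snd p))" using c by (simp add: case_prod_beta')
    moreover have "continuous_on UNIV (\<lambda>p::'a \<times> 'a. k c (snd p))"
    proof -
      have "continuous_on UNIV (\<lambda>p::'a \<times> 'a. (c, snd p))" by (intro continuous_intros)
      from continuous_on_compose2[OF c' this] show ?thesis by simp
    qed
    ultimately show "open {p. k (fst p) (snd p) < k c (snd p) + e}"
      by (intro open_Collect_less continuous_intros)
    \<comment> \<open>The strict inequality relies on the finiteness of a continuous kernel.\<close>
    have "k c y < k c y + e" for y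
      using f[of c y] e ennreal_add_left_cancel_less[of "k c y" 0 e] by auto
    then show "{c} \<times> K \<subseteq> {p. k (fst p) (snd p) < k c (snd p) + e}" by auto
  qed
  then have "\<exists>V. \<forall>c. open (V c) \<and> c \<in> V c \<and> V c \<times> K \<subseteq> {p. k (fst p) (snd p) < k c (snd p) + e}"
    by (intro choice allI)
  then obtain V where
    "\<forall>c. open (V c) \<and> c \<in> V c \<and> V c \<times> K \<subseteq> {p. k (fst p) (snd p) < k c (snd p) + e}" ..
  then have V: "open (V c)" "c \<in> V c"
    "V c \<times> K \<subseteq> {p. k (fst p) (snd p) < k c (snd p) + e}" for c by simp_all
  obtain F where F: "F \<subseteq> K" "finite F" "K \<subseteq> (\<Union>c\<in>F. V c)"
    by (rule compactE_image[OF K, of K V]) (use V in auto)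
  have "\<exists>c\<in>F. \<forall>y\<in>K. k x y \<le> k c y + e" if x: "x \<in> K" for x
  proof -
    obtain c where "c \<in> F" "x \<in> V c" using F(3) x by blast
    then show ?thesis using V(3)[of c] by (intro bexI[of _ c]) (auto intro: less_imp_le)
  qed
  with F show ?thesis by blast
qed

theorem theorem6p7:
  fixes k :: "'a::t2_space \<Rightarrow> 'a \<Rightarrow> ennreal" and K :: "'a set"
  assumes "locally_compact_space (euclidean :: 'a topology)"
    and "symmetric_lsc_kernel k"
    and "compact K" and "K \<noteq> {}"
  shows "(\<exists>a. average_set k K = {a}) \<and>
         (continuous_kernel k \<longrightarrow> (\<exists>r. rendezvous_set k K = {r}))"
proof (intro conjI impI)
  note k = assms(2) and K = assms(3,4)
  have sym: "k x y = k y x" for x y using k by (simp add: symmetric_lsc_kernel_def)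
  define avg where "avg n w x = (\<Sum>j=1..n. k x (w j)) / of_nat n" for n and w :: "nat \<Rightarrow> 'a" and x
  have avg: "\<exists>M\<in>prob_measures_on K. potential k M = avg n w"
    if nw: "n \<ge> 1" "\<forall>j\<in>{1..n}. w j \<in> K" for n w
  proof -
    obtain M where M: "M \<in> prob_measures_on K"
      "\<forall>f\<in>borel_measurable borel. (\<integral>\<^sup>+ y. f y \<partial>M) = (\<Sum>j=1..n. f (w j)) / of_nat n"
      using average_measure[of n w K] nw by blast
    have "potential k M x = avg n w x" for x
      using M(2) kernel_measurable[OF k, of x] by (simp add: potential_def avg_def)
    with M(1) show ?thesis by blast
  qed
  \<comment> \<open>Symmetry of \<open>k\<close> brings both alternatives of
    \<open>finite_minimax\<close> into the form \<open>avg\<close>, with the averaged points in the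
    second argument.\<close>
  have minimax: "(\<exists>n\<ge>1. \<exists>w. (\<forall>j\<in>{1..n}. w j \<in> K) \<and> s \<le> (INF y\<in>K. avg n w y)) \<or>
      (\<exists>n\<ge>1. \<exists>v. (\<forall>j\<in>{1..n}. v j \<in> K) \<and> (\<forall>x\<in>F. avg n v x \<le> t))"
    if F: "finite F" "F \<noteq> {}" "F \<subseteq> K" and st: "s < t" for F s t
    using finite_minimax[OF F(1,2) st, of K k]
  proof (elim disjE exE conjE)
    fix n w assume n: "1 \<le> n" and w: "\<forall>j\<in>{1..n}. w j \<in> F"
      and le: "\<forall>y\<in>K. s \<le> (\<Sum>j=1..n. k (w j) y) / of_nat n"
    have "s \<le> (INF y\<in>K. avg n w y)"
      using le by (intro INF_greatest) (simp add: avg_def sym[of _ "w _"])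
    moreover have "\<forall>j\<in>{1..n}. w j \<in> K" using w F(3) by blast
    ultimately show ?thesis using n by blast
  qed (unfold avg_def, blast)
  have "average_set k K = (\<Inter>M\<in>prob_measures_on K. {INF x\<in>K. potential k M x..SUP x\<in>K. potential k M x})"
    unfolding average_set_def using K(2) by (simp add: closed_convex_hull_eq_Icc)
  moreover have "\<exists>a. (\<Inter>M\<in>prob_measures_on K. {INF x\<in>K. potential k M x..SUP x\<in>K. potential k M x}) = {a}"
  proof (rule INT_Icc_singleton)
    fix s t :: ennreal assume st: "s < t"
    show "(\<exists>M\<in>prob_measures_on K. s \<le> (INF x\<in>K. potential k M x)) \<or>
        (\<exists>M\<in>prob_measures_on K. (SUP x\<in>K. potential k M x) \<le> t)"
    proof (rule disj_imp[THEN iffD2], rule impI)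
      \<comment> \<open>Finite averages are potentials, so \<open>no\<close> excludes the first
        alternative of \<open>minimax\<close> for every finite \<open>F\<close>. What remains is the
        hypothesis of the compactness lemma.\<close>
      assume no: "\<not> (\<exists>M\<in>prob_measures_on K. s \<le> (INF x\<in>K. potential k M x))"
      have "\<exists>M\<in>prob_measures_on K. \<forall>x\<in>K. potential k M x \<le> t"
      proof (rule potential_le_by_compactness[OF k K])
        fix F assume F: "finite F" "F \<noteq> {}" "F \<subseteq> K"
        from minimax[OF F st] show "\<exists>n\<ge>1. \<exists>v. (\<forall>j\<in>{1..n}. v j \<in> K) \<and>
            (\<forall>x\<in>F. (\<Sum>j=1..n. k x (v j)) / of_nat n \<le> t)"
        proof (elim disjE exE conjE)
          fix n w assume n: "1 \<le> n" "\<forall>j\<in>{1..n}. w j \<in> K" and s: "s \<le> (INF y\<in>K. avg n w y)"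
          from avg[OF n] s no have False by metis
          then show ?thesis ..
        qed (unfold avg_def, blast)
      qed
      then show "\<exists>M\<in>prob_measures_on K. (SUP x\<in>K. potential k M x) \<le> t"
        by (auto intro: SUP_least)
    qed
  qed (rule INF_potential_le_SUP_potential[OF k K(1)])
  ultimately show "\<exists>a. average_set k K = {a}" by simp

  assume ck: "continuous_kernel k"
  \<comment> \<open>Pairs of a length and a sequence merge the double intersection into one, as the
    interval lemma requires.\<close>
  define I :: "(nat \<times> (nat \<Rightarrow> 'a)) set" where "I = {(n, w). n \<ge> 1 \<and> (\<forall>j\<in>{1..n}. w j \<in> K)}"
  have "rendezvous_set k K = (\<Inter>(n, w)\<in>I. closed_convex_hull (avg n w ` K))"
    unfolding rendezvous_set_def I_def avg_def[abs_def] by auto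
  also have "\<dots> = (\<Inter>i\<in>I. {INF x\<in>K. avg (fst i) (snd i) x..SUP x\<in>K. avg (fst i) (snd i) x})"
    using K(2) by (simp add: closed_convex_hull_eq_Icc case_prod_beta')
  also have "\<exists>r. \<dots> = {r}"
  proof (rule INT_Icc_singleton)
    fix i i' assume "i \<in> I" "i' \<in> I"
    then obtain M N where M: "M \<in> prob_measures_on K" "potential k M = avg (fst i) (snd i)"
      and N: "N \<in> prob_measures_on K" "potential k N = avg (fst i') (snd i')"
      using avg[of "fst i" "snd i"] avg[of "fst i'" "snd i'"] by (auto simp: I_def)
    show "(INF x\<in>K. avg (fst i) (snd i) x) \<le> (SUP x\<in>K. avg (fst i') (snd i') x)"
      using INF_potential_le_SUP_potential[OF k K(1) M(1) N(1)] by (simp add: M(2) N(2))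
  next
    fix s t :: ennreal assume "s < t"
    \<comment> \<open>The gap is divided in two: the finite minimax uses \<open>s < a\<close>, and
      the remainder \<open>e = t - a\<close> is the error allowed for the net.\<close>
    then obtain a where a: "s < a" "a < t" using dense by blast
    define e where "e = t - a"
    have e: "e > 0" "a + e = t" using a by (auto simp: e_def diff_gr0_ennreal add_diff_inverse_ennreal)
    obtain F where F: "F \<subseteq> K" "finite F" "\<forall>x\<in>K. \<exists>c\<in>F. \<forall>y\<in>K. k x y \<le> k c y + e"
      using continuous_kernel_finite_net[OF ck K(1) e(1)] by blast
    have "F \<noteq> {}" using F(3) K(2) by blast
    from minimax[OF F(2) this F(1) a(1)]
    show "(\<exists>i\<in>I. s \<le> (INF x\<in>K. avg (fst i) (snd i) x)) \<or>
        (\<exists>i\<in>I. (SUP x\<in>K. avg (fst i) (snd i) x) \<le> t)"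
    proof (elim disjE exE conjE)
      fix n w assume "1 \<le> n" "\<forall>j\<in>{1..n}. w j \<in> K" "s \<le> (INF y\<in>K. avg n w y)"
      then show ?thesis by (intro disjI1 bexI[of _ "(n, w)"]) (auto simp: I_def)
    next
      fix n v assume n: "1 \<le> n" and v: "\<forall>j\<in>{1..n}. v j \<in> K" and le: "\<forall>x\<in>F. avg n v x \<le> a"
      have "avg n v x \<le> t" if x: "x \<in> K" for x
      proof -
        obtain c where c: "c \<in> F" "\<forall>y\<in>K. k x y \<le> k c y + e" using F(3) x by blast
        \<comment> \<open>Moving from \<open>x\<close> to its net point \<open>c\<close> changes
          each summand by at most \<open>e\<close>, hence also the average.\<close>
        have "avg n v x \<le> (\<Sum>j=1..n. k c (v j) + e) / of_nat n"
          unfolding avg_def using c(2) v by (intro divide_right_mono_ennreal sum_mono) auto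
        also have "\<dots> = avg n v c + of_nat n * e / of_nat n"
          by (simp add: avg_def sum.distrib add_divide_distrib_ennreal)
        also have "of_nat n * e / of_nat n = e"
          using n by (subst mult.commute, subst mult_divide_eq_ennreal) (auto simp: ennreal_of_nat_eq_real_of_nat)
        also have "avg n v c + e \<le> a + e" using le c(1) by (intro add_right_mono) blast
        finally show ?thesis using e(2) by simp
      qed
      then have "(SUP x\<in>K. avg n v x) \<le> t" by (rule SUP_least)
      then show ?thesis using n v by (intro disjI2 bexI[of _ "(n, v)"]) (auto simp: I_def)
    qed
  qed
  finally show "\<exists>r. rendezvous_set k K = {r}" .
qed

end
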